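(* Let $k$ be a complete valuation field and let $V$ be a Banach $k$-vector space. If $\#V=\mathrm{rank}(V)$ and the cardinal $\mathrm{rank}(V)$ is weakly compact, then the following are equivalent: (1) $V$ is free. (2) $V$ is almost free.
   Context: $\#X$ denotes the cardinality of the underlying set of $X$. A complete valuation field is a field $k$ with a map $|\cdot|:k\to\mathbb{R}_{\ge 0}$ such that $|c|=0$ iff $c=0$, $|c_0-c_1|\le\max\{|c_0|,|c_1|\}$, $|c_0c_1|=|c_0||c_1|$, and $k$ is complete for the ultrametric $|c_0-c_1|$ (the trivial valuation is allowed). A Banach $k$-vector space is a $k$-vector space $V$ with a map $\|\cdot\|:V\to\mathbb{R}_{\ge 0}$ such that $\|v\|=0$ iff $v=0$, $\|v_0-v_1\|\le\max\{\|v_0\|,\|v_1\|\}$, $\|cv\|=|c|\|v\|$, and $V$ is complete for the ultrametric $\|v_0-v_1\|$. Closed $k$-linear subspaces carry the restricted norm and are Banach $k$-vector spaces. For a set $E$, $C_0(E,k)$ is the Banach $k$-vector space of maps $c:E\to k$ such that $\{e\in E:|c(e)|\ge\epsilon\}$ is finite for every $\epsilon>0$, with the norm $\|c\|=\sup_{e\in E}|c(e)|$ (equal to $0$ if $E=\emptyset$). An orthonormal Schauder basis of $V$ is a subset $E\subset V$ such that $\|e\|=1$ for all $e\in E$; $\|\sum_{e\in E}c(e)e\|=\|c\|$ for all $c\in C_0(E,k)$; and every $v\in V$ equals $\sum_{e\in E}c(e)e$ for some $c\in C_0(E,k)$ (the sums being the usual limits of finite sums). For $S\subset V$, $\langle S\rangle$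 is the closure of the $k$-linear span of $S$. $\mathrm{rank}(V)$ is the minimum cardinality of a subset $S\subset V$ with $V=\langle S\rangle$. $V$ is free if it admits an orthonormal Schauder basis; for a cardinal $\kappa$, $V$ is $\kappa$-free if every closed subspace of the form $\langle S\rangle$ with $S\subset V$, $\#S<\kappa$, is free; $V$ is almost free if it is $\mathrm{rank}(V)$-free. A cardinal $\kappa$ is weakly compact if $\kappa\ge\aleph_1$ and for every map $f$ from the set of two-element subsets of $\kappa$ to $\{0,1\}$ there is a subset $S\subset\kappa$ of cardinality $\kappa$ such that $f$ is constant on the set of two-element subsets of $S$. *)

theory Defs
  imports "HOL-Analysis.Analysis" "HOL-Library.Ramsey"
begin

unbundle cardinal_syntax

text \<open>
  The library constant \<open>norm\<close> is constrained to real normed spaces, hence a new one.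
  Its nonnegativity is not listed below: it follows from \<open>dist x y = ultranorm (x - y)\<close>
  and the metric space axioms.  Topology and completeness are those of this metric.
\<close>

class complete_ultranormed_group = ab_group_add + complete_space +
  fixes ultranorm :: "'a \<Rightarrow> real"
  assumes dist_ultranorm: "dist x y = ultranorm (x - y)"
    and ultranorm_eq_0_iff: "ultranorm x = 0 \<longleftrightarrow> x = 0"
    and ultranorm_diff_le: "ultranorm (x - y) \<le> max (ultranorm x) (ultranorm y)"

class complete_valuation_field = field + complete_ultranormed_group +
  assumes valuation_mult: "ultranorm (x * y) = ultranorm x * ultranorm y"

lemma ultranorm_nonneg: "0 \<le> ultranorm (x :: 'a :: complete_ultranormed_group)"
  using zero_le_dist[of x 0] by (simp add: dist_ultranorm)

text \<open>
  Elements of \<open>C\<^sub>0(E, k)\<close> are represented by total functions; all notions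
  below only depend on their values on \<open>E\<close>.
\<close>

definition C0 :: "'e set \<Rightarrow> ('e \<Rightarrow> 'k :: complete_valuation_field) set" where
  "C0 E = {c. \<forall>\<epsilon>>0. finite {e \<in> E. ultranorm (c e) \<ge> \<epsilon>}}"

definition C0_norm :: "'e set \<Rightarrow> ('e \<Rightarrow> 'k :: complete_valuation_field) \<Rightarrow> real" where
  "C0_norm E c = (if E = {} then 0 else SUP e\<in>E. ultranorm (c e))"

locale ultrametric_banach_space = vector_space scale
  for scale :: "'k :: complete_valuation_field \<Rightarrow> 'v :: complete_ultranormed_group \<Rightarrow> 'v"
    (infixr \<open>*s\<close> 75) +
  assumes ultranorm_scale: "ultranorm (c *s v) = ultranorm c * ultranorm v"
begin

text \<open>
  The notions are defined for a closed subspace \<open>W\<close> with the restricted norm; the whole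
  space is \<open>W = UNIV\<close>.
\<close>

definition closed_span :: "'v set \<Rightarrow> 'v set" where
  "closed_span S = closure (span S)"

definition orthonormal_Schauder_basis :: "'v set \<Rightarrow> 'v set \<Rightarrow> bool" where
  "orthonormal_Schauder_basis W E \<longleftrightarrow>
     E \<subseteq> W \<and>
     (\<forall>e\<in>E. ultranorm e = 1) \<and>
     (\<forall>c\<in>C0 E. \<exists>v. ((\<lambda>e. c e *s e) has_sum v) E \<and> ultranorm v = C0_norm E c) \<and>
     (\<forall>v\<in>W. \<exists>c\<in>C0 E. ((\<lambda>e. c e *s e) has_sum v) E)"

definition free :: "'v set \<Rightarrow> bool" where
  "free W \<longleftrightarrow> (\<exists>E. orthonormal_Schauder_basis W E)"

text \<open>
  Cardinals are represented by cardinal orders, up to \<open>=o\<close>.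
\<close>

definition Banach_rank :: "'v set \<Rightarrow> 'v rel" where
  "Banach_rank W =
     (SOME r. r \<in> {|S| |S. closed_span S = W} \<and>
              (\<forall>r' \<in> {|S| |S. closed_span S = W}. r \<le>o r'))"

definition cardinal_free :: "'b rel \<Rightarrow> 'v set \<Rightarrow> bool" where
  "cardinal_free \<kappa> W \<longleftrightarrow> (\<forall>S\<subseteq>W. |S| <o \<kappa> \<longrightarrow> free (closed_span S))"

definition almost_free :: "'v set \<Rightarrow> bool" where
  "almost_free W \<longleftrightarrow> cardinal_free (Banach_rank W) W"

lemma Banach_rank_minimal:
  assumes "closed_span T = W"
  shows "\<exists>S. closed_span S = W \<and> Banach_rank W = |S|"
    and "Banach_rank W \<le>o |T|"
    and "Card_order (Banach_rank W)"
proof -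
  let ?R = "{|S| |S. closed_span S = W}"
  have "?R \<noteq> {}" "\<forall>r\<in>?R. Card_order r"
    using assms card_of_Card_order by auto
  then have "\<exists>r. r \<in> ?R \<and> (\<forall>r'\<in>?R. r \<le>o r')"
    using exists_minim_Card_order[of ?R] by blast
  then have *: "Banach_rank W \<in> ?R \<and> (\<forall>r'\<in>?R. Banach_rank W \<le>o r')"
    unfolding Banach_rank_def by (rule someI_ex)
  show "\<exists>S. closed_span S = W \<and> Banach_rank W = |S|" "Banach_rank W \<le>o |T|"
    using * assms by blast+
  show "Card_order (Banach_rank W)"
    using * card_of_Card_order by auto
qed

lemma closed_span_UNIV: "closed_span UNIV = UNIV"
  by (simp add: closed_span_def)

end

text \<open>
  \<open>cardSuc natLeq\<close> is the first uncountable cardinal, \<open>nsets A 2\<close> the set of two-element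
  subsets of \<open>A\<close>.
\<close>

definition weakly_compact_cardinal :: "'a rel \<Rightarrow> bool" where
  "weakly_compact_cardinal \<kappa> \<longleftrightarrow>
     Card_order \<kappa> \<and> cardSuc natLeq \<le>o \<kappa> \<and>
     (\<forall>f \<in> nsets (Field \<kappa>) 2 \<rightarrow> {0, 1 :: nat}.
        \<exists>S\<subseteq>Field \<kappa>. |S| =o \<kappa> \<and> (\<exists>i. \<forall>X\<in>nsets S 2. f X = i))"

end

theory Submission
  imports Defs
begin

text \<open>
  Write \<open>cl S\<close> for the closed linear span of \<open>S\<close>.  Throughout, bases are handled through a
  finite criterion: \<open>E\<close> is an orthonormal Schauder basis of \<open>cl E\<close> as soon as its elements have norm
  \<open>1\<close> and no coefficient of a finite linear combination exceeds the norm of that combination.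

  If \<open>V\<close> is almost free, it is free.  Let \<open>\<kappa>\<close> be its rank and cardinality, well-order \<open>V\<close> in type \<open>\<kappa>\<close>,
  and for every \<open>a\<close> choose an orthonormal basis \<open>E a\<close> of the closed span \<open>V a\<close> of the predecessors of
  \<open>a\<close>.  Each \<open>v\<close> preceding \<open>a\<close> lies in the closed span of a countable part of \<open>E a\<close>, which in turn
  lies in the closed span of countably many predecessors \<open>s a v n\<close> of \<open>a\<close>.
  Weak compactness makes these choices coherent (\<open>simultaneous_stabilization\<close>): there is a
  function \<open>h\<close> such that for every set \<open>X\<close> of fewer than \<open>\<kappa>\<close> vectors some \<open>a\<close> above \<open>X\<close> satisfies
  \<open>s a v n = h v n\<close> for all \<open>v \<in> X\<close> and all \<open>n\<close>.  If \<open>K \<subseteq> X\<close> is closed under \<open>h\<close>, the part of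
  \<open>E a\<close> in \<open>cl K\<close> is therefore a basis of \<open>cl K\<close>.  The initial segments closed under \<open>h\<close> form a
  continuous filtration of \<open>V\<close>, and in every step \<open>K \<subseteq> K'\<close> a single \<open>E a\<close> splits compatibly with both.
  The parts of these bases in \<open>cl K'\<close> outside \<open>cl K\<close>, collected over all steps, form an orthonormal
  basis of \<open>V\<close> (\<open>free_if_cardinal_free\<close>).  No bound on the size of the subspaces \<open>V a\<close> is needed: only
  the indices \<open>s a v n\<close> are stabilized, never the basis vectors.

  The stabilization rests on the usual argument that from \<open>\<kappa>\<close> many subsets of \<open>\<kappa>\<close> one finds a set
  \<open>H\<close> of size \<open>\<kappa>\<close> which decides each of them up to fewer than \<open>\<kappa>\<close> elements (\<open>deciding_set\<close>).
  If the functions \<open>a \<mapsto> s a v n\<close> are not all essentially constant on \<open>H\<close>, one passes to an essentially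
  unbounded one and substitutes it for the variable \<open>a\<close>.  Since \<open>s a v n\<close> precedes \<open>a\<close>, doing
  this infinitely often would produce an infinite descent.

  If \<open>V\<close> is free, so is each of its closed subspaces \<open>W\<close> (Gruson's theorem,
  \<open>closed_subspace_has_orthonormal_basis\<close>), whatever their rank.  With respect to coordinates
  on \<open>V\<close>, call a set \<open>J\<close> of coordinates good if vectors of \<open>W\<close> can be
  approximated by vectors of \<open>W\<close> supported in \<open>J\<close> as well as by arbitrary vectors supported in \<open>J\<close>.  A good \<open>J\<close> can be enlarged to a good set by countably many
  coordinates, including any countably many prescribed ones (\<open>good_extension\<close>), and a basis of the part
  of \<open>W\<close> supported in \<open>J\<close> extends along such a step by the Gram-Schmidt process, in which the largest
  coordinate outside \<open>J\<close> serves as pivot (\<open>gram_schmidt\<close>).  Zorn's lemma concludes.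
\<close>

section \<open>Weakly compact cardinals\<close>

lemma weakly_compact_cardinal_ordIso:
  fixes \<kappa> :: "'a rel" and \<kappa>' :: "'b rel"
  assumes "weakly_compact_cardinal \<kappa>" "\<kappa> =o \<kappa>'"
  shows "weakly_compact_cardinal \<kappa>'"
proof -
  have \<kappa>: "Card_order \<kappa>" "cardSuc natLeq \<le>o \<kappa>"
    using assms(1) by (simp_all add: weakly_compact_cardinal_def)
  have \<kappa>': "Card_order \<kappa>'"
    using Card_order_ordIso2[OF \<kappa>(1) assms(2)] .
  obtain g where g: "bij_betw g (Field \<kappa>) (Field \<kappa>')"
    using card_of_cong[OF assms(2)] card_of_ordIso[of "Field \<kappa>" "Field \<kappa>'"] by blast
  have "\<exists>S\<subseteq>Field \<kappa>'. |S| =o \<kappa>' \<and> (\<exists>i. \<forall>X\<in>nsets S 2. f X = i)"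
    if f: "f \<in> nsets (Field \<kappa>') 2 \<rightarrow> {0, 1 :: nat}" for f
  proof -
    have image: "g ` X \<in> nsets (g ` S) 2" if "X \<in> nsets S 2" "S \<subseteq> Field \<kappa>" for X S
    proof -
      have "X \<subseteq> Field \<kappa>"
        using that by (auto simp: nsets_def)
      then have "inj_on g X"
        by (rule inj_on_subset[OF bij_betw_imp_inj_on[OF g]])
      then show ?thesis
        using that by (auto simp: nsets_def card_image)
    qed
    have fg: "(\<lambda>X. f (g ` X)) \<in> nsets (Field \<kappa>) 2 \<rightarrow> {0, 1}"
    proof
      fix X assume "X \<in> nsets (Field \<kappa>) 2"
      then have "g ` X \<in> nsets (Field \<kappa>') 2"
        using image[of X "Field \<kappa>"] g by (simp add: bij_betw_def)
      then show "f (g ` X) \<in> {0, 1}"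
        using f by blast
    qed
    have "\<forall>f \<in> nsets (Field \<kappa>) 2 \<rightarrow> {0, 1 :: nat}.
        \<exists>S\<subseteq>Field \<kappa>. |S| =o \<kappa> \<and> (\<exists>i. \<forall>X\<in>nsets S 2. f X = i)"
      using assms(1) unfolding weakly_compact_cardinal_def by (elim conjE)
    from bspec[OF this fg]
    obtain S i where S: "S \<subseteq> Field \<kappa>" "|S| =o \<kappa>" "\<forall>X\<in>nsets S 2. f (g ` X) = i"
      by (elim exE conjE)
    have inj: "inj_on g S"
      using S(1) by (rule inj_on_subset[OF bij_betw_imp_inj_on[OF g]])
    have "|g ` S| =o |S|"
      by (rule ordIso_symmetric[OF card_of_ordIsoI[OF bij_betw_imageI[OF inj refl]]])
    then have "|g ` S| =o \<kappa>'"
      by (rule ordIso_transitive[OF _ ordIso_transitive[OF S(2) assms(2)]])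
    moreover have "f Y = i" if "Y \<in> nsets (g ` S) 2" for Y
    proof -
      obtain X where X: "X \<subseteq> S" "Y = g ` X"
        using \<open>Y \<in> nsets (g ` S) 2\<close> by (auto simp: nsets_def subset_image_iff)
      have "inj_on g X"
        using inj X(1) by (rule inj_on_subset)
      then have "X \<in> nsets S 2"
        using X \<open>Y \<in> nsets (g ` S) 2\<close> by (auto simp: nsets_def card_image finite_image_iff)
      then show ?thesis
        using S(3) X(2) by blast
    qed
    moreover have "g ` S \<subseteq> Field \<kappa>'"
      using g S(1) by (auto simp: bij_betw_def)
    ultimately show ?thesis
      by (intro exI[of _ "g ` S"] conjI exI[of _ i] ballI)
  qed
  moreover have "cardSuc natLeq \<le>o \<kappa>'"
    using \<kappa>(2) assms(2) by (rule ordLeq_ordIso_trans)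
  ultimately show ?thesis
    using \<kappa>' by (simp add: weakly_compact_cardinal_def)
qed

text \<open>
  A weakly compact cardinal, carried by a well-order of a whole type.
\<close>

locale weakly_compact_order =
  fixes \<kappa> :: "'a rel"
  assumes weakly_compact: "weakly_compact_cardinal \<kappa>"
    and Field_eq_UNIV: "Field \<kappa> = UNIV"
begin

text \<open>
  The strict part of the well-order.
\<close>

definition prec :: "'a \<Rightarrow> 'a \<Rightarrow> bool" (infix \<open>\<sqsubset>\<close> 50) where
  "a \<sqsubset> b \<longleftrightarrow> (a, b) \<in> \<kappa> \<and> a \<noteq> b"

abbreviation small :: "'b set \<Rightarrow> bool" where
  "small X \<equiv> |X| <o \<kappa>"

lemma Card_order: "Card_order \<kappa>"
  using weakly_compact by (simp add: weakly_compact_cardinal_def)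

lemma Well_order: "Well_order \<kappa>"
  using Card_order by (simp add: card_order_on_def)

lemma card_UNIV: "|UNIV :: 'a set| =o \<kappa>"
  using card_of_Field_ordIso[OF Card_order] by (simp add: Field_eq_UNIV)

lemma prec_linear: "a \<sqsubset> b \<or> a = b \<or> b \<sqsubset> a"
  using Well_order Field_eq_UNIV
  unfolding prec_def well_order_on_def linear_order_on_def total_on_def by auto

lemma prec_trans: "a \<sqsubset> b \<Longrightarrow> b \<sqsubset> c \<Longrightarrow> a \<sqsubset> c"
  using Well_order
  unfolding prec_def well_order_on_def linear_order_on_def partial_order_on_def preorder_on_def
    trans_def antisym_def by blast

lemma prec_irrefl: "\<not> a \<sqsubset> a"
  by (simp add: prec_def)

lemma wf_prec: "wf {(a, b). a \<sqsubset> b}"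
proof -
  have "{(a, b). a \<sqsubset> b} = \<kappa> - Id"
    by (auto simp: prec_def)
  then show ?thesis
    using Well_order by (simp add: well_order_on_def)
qed

lemma wfP_prec: "wfP (\<sqsubset>)"
  using wf_prec by (simp add: wfp_def)

lemma natLeq_less: "natLeq <o \<kappa>"
  using weakly_compact natLeq_Card_order Card_order
  by (simp add: weakly_compact_cardinal_def cardSuc_ordLess_ordLeq)

lemma small_countable: "countable X \<Longrightarrow> small X"
proof -
  assume "countable X"
  then have "|X| \<le>o |UNIV :: nat set|"
    unfolding countable_def card_of_ordLeq[symmetric] by auto
  then have "|X| \<le>o natLeq"
    using card_of_nat ordLeq_ordIso_trans by blast
  then show ?thesis
    using natLeq_less by (rule ordLeq_ordLess_trans)
qed

lemma infinite_UNIV: "infinite (UNIV :: 'a set)"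
  using small_countable[OF countable_finite, of "UNIV :: 'a set"] card_UNIV not_ordLess_ordIso
  by blast

lemma Cinfinite: "Cinfinite \<kappa>"
  using Card_order infinite_UNIV by (simp add: cinfinite_def Field_eq_UNIV)

lemma small_initial_segment: "small {b. b \<sqsubset> a}"
proof -
  have "{b. b \<sqsubset> a} = underS \<kappa> a"
    by (auto simp: underS_def prec_def)
  then show ?thesis
    using card_of_underS[OF Card_order] by (simp add: Field_eq_UNIV)
qed

lemma small_subset: "X \<subseteq> Y \<Longrightarrow> small Y \<Longrightarrow> small X"
  using card_of_mono1 ordLeq_ordLess_trans by blast

lemma not_small: "|X| =o \<kappa> \<Longrightarrow> \<not> small X"
  using not_ordLess_ordIso by blast

text \<open>
  The partition property for a not necessarily symmetric relation, read along the well-order.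
\<close>

lemma homogeneous_set:
  fixes R :: "'a \<Rightarrow> 'a \<Rightarrow> bool"
  obtains H where "|H| =o \<kappa>"
    and "(\<forall>a\<in>H. \<forall>b\<in>H. a \<sqsubset> b \<longrightarrow> R a b) \<or> (\<forall>a\<in>H. \<forall>b\<in>H. a \<sqsubset> b \<longrightarrow> \<not> R a b)"
proof -
  define f :: "'a set \<Rightarrow> nat"
    where "f X = (if \<exists>a b. X = {a, b} \<and> a \<sqsubset> b \<and> R a b then 1 else 0)" for X
  have "f \<in> nsets (Field \<kappa>) 2 \<rightarrow> {0, 1}"
    by (auto simp: f_def)
  then obtain H i where H: "|H| =o \<kappa>" "\<forall>X\<in>nsets H 2. f X = i"
    using weakly_compact unfolding weakly_compact_cardinal_def by blast
  have f: "f {a, b} = (if R a b then 1 else 0)" if "a \<sqsubset> b" for a b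
    using that prec_trans prec_irrefl unfolding f_def by (auto simp: doubleton_eq_iff)
  have "R a b \<longleftrightarrow> i = 1" if "a \<in> H" "b \<in> H" "a \<sqsubset> b" for a b
  proof -
    have "{a, b} \<in> nsets H 2"
      using that prec_irrefl by auto
    then show ?thesis
      using H(2) f[OF that(3)] by auto
  qed
  then have "(\<forall>a\<in>H. \<forall>b\<in>H. a \<sqsubset> b \<longrightarrow> R a b) \<or> (\<forall>a\<in>H. \<forall>b\<in>H. a \<sqsubset> b \<longrightarrow> \<not> R a b)"
    by (cases "i = 1") simp_all
  then show thesis by (rule that[OF H(1)])
qed

text \<open>
  A cofinal set \<open>K\<close> of size less than \<open>\<kappa>\<close> would give a function \<open>f\<close> into \<open>K\<close> with bounded fibres.
  A set homogeneous for the relation \<open>f a = f b\<close> either lies in one fibre or is mapped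
  injectively into \<open>K\<close>; both contradict its size.
\<close>

lemma regular: "regularCard \<kappa>"
  unfolding regularCard_def
proof (intro allI impI, rule ccontr)
  fix K
  assume K: "K \<subseteq> Field \<kappa> \<and> cofinal K \<kappa>" and "\<not> |K| =o \<kappa>"
  moreover have "|K| \<le>o \<kappa>"
    using card_of_mono1[of K UNIV] card_UNIV ordLeq_ordIso_trans by auto
  ultimately have "small K"
    using ordLeq_iff_ordLess_or_ordIso by blast
  have "\<exists>k\<in>K. a \<sqsubset> k" for a
    using K unfolding cofinal_def prec_def Field_eq_UNIV by auto
  then obtain f where f: "\<And>a. f a \<in> K" "\<And>a. a \<sqsubset> f a"
    by metis
  obtain H where H: "|H| =o \<kappa>"
    and hom: "(\<forall>a\<in>H. \<forall>b\<in>H. a \<sqsubset> b \<longrightarrow> f a = f b) \<or> (\<forall>a\<in>H. \<forall>b\<in>H. a \<sqsubset> b \<longrightarrow> f a \<noteq> f b)"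
    using homogeneous_set[of "\<lambda>a b. f a = f b"] by blast
  from hom show False
  proof
    assume eq: "\<forall>a\<in>H. \<forall>b\<in>H. a \<sqsubset> b \<longrightarrow> f a = f b"
    have "H \<noteq> {}"
      using not_small[OF H] small_countable by force
    then obtain a where a: "a \<in> H" by blast
    have "f b = f a" if "b \<in> H" for b
      using prec_linear[of a b] eq a that by metis
    then have "H \<subseteq> {b. b \<sqsubset> f a}"
      using f(2) by (metis mem_Collect_eq subsetI)
    then show False
      using not_small[OF H] small_subset small_initial_segment by blast
  next
    assume "\<forall>a\<in>H. \<forall>b\<in>H. a \<sqsubset> b \<longrightarrow> f a \<noteq> f b"
    then have "inj_on f H"
      unfolding inj_on_def using prec_linear by metis
    then have "|H| \<le>o |K|"
      using f(1) card_of_ordLeq[of H K] by blast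
    then show False
      using \<open>small K\<close> not_small[OF H] ordLeq_ordLess_trans by blast
  qed
qed

lemma small_UN: "small I \<Longrightarrow> (\<And>i. i \<in> I \<Longrightarrow> small (X i)) \<Longrightarrow> small (\<Union>i\<in>I. X i)"
  using regular Cinfinite
  by (intro card_of_UNION_ordLess_infinite_Field_regularCard) auto

lemma small_Un: "small X \<Longrightarrow> small Y \<Longrightarrow> small (X \<union> Y)"
  using card_of_Un_ordLess_infinite_Field[of \<kappa> X Y] Card_order infinite_UNIV
  by (simp add: Field_eq_UNIV)

text \<open>
  Identify \<open>a\<close> with the sequence of truth values \<open>a \<in> A i\<close>, and colour pairs by whether the
  lexicographic order on these sequences agrees with the well-order.  Along a homogeneous set the
  sequences are monotone, and by induction on \<open>i\<close> each entry is eventually constant.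
\<close>

lemma deciding_set:
  fixes A :: "'i \<Rightarrow> 'a set"
  assumes "|UNIV :: 'i set| \<le>o \<kappa>"
  obtains H where "|H| =o \<kappa>" and "\<And>i. small (H \<inter> A i) \<or> small (H - A i)"
proof -
  have "|UNIV :: 'i set| \<le>o |UNIV :: 'a set|"
    using assms card_UNIV ordIso_symmetric ordLeq_ordIso_trans by blast
  then obtain \<phi> :: "'i \<Rightarrow> 'a" where \<phi>: "inj \<phi>"
    using card_of_ordLeq[of "UNIV :: 'i set" "UNIV :: 'a set"] by auto
  define B where "B = A \<circ> inv \<phi>"
  have AB: "A i = B (\<phi> i)" for i
    using \<phi> by (simp add: B_def)
  \<comment> \<open>\<open>R a b\<close>: the sequence of \<open>a\<close> is lexicographically smaller than that of \<open>b\<close>.\<close>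
  define R where
    "R a b \<longleftrightarrow> (\<exists>i. (\<forall>j. j \<sqsubset> i \<longrightarrow> (a \<in> B j \<longleftrightarrow> b \<in> B j)) \<and> a \<notin> B i \<and> b \<in> B i)" for a b
  obtain H where H: "|H| =o \<kappa>"
    and hom: "(\<forall>a\<in>H. \<forall>b\<in>H. a \<sqsubset> b \<longrightarrow> R a b) \<or> (\<forall>a\<in>H. \<forall>b\<in>H. a \<sqsubset> b \<longrightarrow> \<not> R a b)"
    using homogeneous_set by blast
  have "small (H \<inter> B i) \<or> small (H - B i)" for i
  proof (induction i rule: wfp_induct_rule[OF wfP_prec])
    case (1 i)
    define X where "X j = (if small (H \<inter> B j) then H \<inter> B j else H - B j)" for j
    have "small (X j)" if "j \<sqsubset> i" for j
      using 1 that by (auto simp: X_def)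
    then have small_X: "small (\<Union>j\<in>{j. j \<sqsubset> i}. X j)"
      by (intro small_UN small_initial_segment) auto
    define H' where "H' = H - (\<Union>j\<in>{j. j \<sqsubset> i}. X j)"
    \<comment> \<open>Outside a small set all sequences agree below \<open>i\<close>, so their entries at \<open>i\<close> are monotone.\<close>
    have agree: "a \<in> B j \<longleftrightarrow> b \<in> B j" if "j \<sqsubset> i" "a \<in> H'" "b \<in> H'" for a b j
      using that unfolding H'_def X_def by (auto split: if_splits)
    have small_H': "small (H \<inter> Y)" if "small (H' \<inter> Y)" for Y
      by (rule small_subset[OF _ small_Un[OF that small_X]]) (auto simp: H'_def)
    from hom consider
        "\<forall>a\<in>H'. \<forall>b\<in>H'. a \<sqsubset> b \<longrightarrow> a \<in> B i \<longrightarrow> b \<in> B i"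
      | "\<forall>a\<in>H'. \<forall>b\<in>H'. a \<sqsubset> b \<longrightarrow> b \<in> B i \<longrightarrow> a \<in> B i"
    proof (elim disjE)
      assume R: "\<forall>a\<in>H. \<forall>b\<in>H. a \<sqsubset> b \<longrightarrow> R a b"
      have "b \<in> B i" if ab: "a \<in> H'" "b \<in> H'" "a \<sqsubset> b" "a \<in> B i" for a b
      proof -
        have "R a b"
          using R ab by (auto simp: H'_def)
        then obtain i' where "\<forall>j. j \<sqsubset> i' \<longrightarrow> (a \<in> B j \<longleftrightarrow> b \<in> B j)" "a \<notin> B i'" "b \<in> B i'"
          by (auto simp: R_def)
        then show ?thesis
          using agree[of i' a b] prec_linear[of i i'] ab by auto
      qed
      then show thesis using that(1) by blast
    next
      assume R: "\<forall>a\<in>H. \<forall>b\<in>H. a \<sqsubset> b \<longrightarrow> \<not> R a b"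
      have "a \<in> B i" if ab: "a \<in> H'" "b \<in> H'" "a \<sqsubset> b" "b \<in> B i" for a b
      proof -
        have "\<not> R a b"
          using R ab by (auto simp: H'_def)
        then show ?thesis
          using agree ab unfolding R_def by blast
      qed
      then show thesis using that(2) by blast
    qed
    then show ?case
    proof cases
      case 1
      show ?thesis
      proof (cases "H' \<inter> B i = {}")
        case True
        then have "small (H' \<inter> B i)"
          using small_countable[of "{}"] by simp
        then show ?thesis using small_H' by blast
      next
        case False
        then obtain a where "a \<in> H'" "a \<in> B i" by blast
        then have "H' \<inter> - B i \<subseteq> {b. b \<sqsubset> a}"
          using 1 prec_linear by blast
        then have "small (H' \<inter> - B i)"
          using small_subset small_initial_segment by blast
        then show ?thesis using small_H'[of "- B i"] by (simp add: Diff_eq)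
      qed
    next
      case 2
      show ?thesis
      proof (cases "H' \<inter> - B i = {}")
        case True
        then have "small (H' \<inter> - B i)"
          using small_countable[of "{}"] by simp
        then show ?thesis using small_H'[of "- B i"] by (simp add: Diff_eq)
      next
        case False
        then obtain a where "a \<in> H'" "a \<notin> B i" by blast
        then have "H' \<inter> B i \<subseteq> {b. b \<sqsubset> a}"
          using 2 prec_linear by blast
        then have "small (H' \<inter> B i)"
          using small_subset small_initial_segment by blast
        then show ?thesis using small_H' by blast
      qed
    qed
  qed
  then have "small (H \<inter> A i) \<or> small (H - A i)" for i
    using AB by simp
  with H that show thesis by blast
qed

text \<open>
  The lists index the iterated substitutions in the next argument.
\<close>

lemma card_lists: "|UNIV :: ('a \<times> nat) list set| \<le>o \<kappa>"
proof -
  have nat: "|UNIV :: nat set| \<le>o \<kappa>"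
    using small_countable[of "UNIV :: nat set"] ordLess_imp_ordLeq by auto
  have UNIV_le: "|UNIV :: 'a set| \<le>o \<kappa>"
    using card_UNIV ordIso_imp_ordLeq by blast
  have inf: "\<not> finite (Field \<kappa>)"
    using infinite_UNIV by (simp add: Field_eq_UNIV)
  have pairs: "|UNIV :: ('a \<times> nat) set| \<le>o \<kappa>"
    using card_of_Times_ordLeq_infinite_Field[OF inf UNIV_le nat Card_order] by simp
  have "|{l :: ('a \<times> nat) list. length l = n}| \<le>o \<kappa>" for n
  proof (induction n)
    case 0
    have "countable {l :: ('a \<times> nat) list. length l = 0}"
      by simp
    then show ?case using small_countable ordLess_imp_ordLeq by blast
  next
    case (Suc n)
    have "{l :: ('a \<times> nat) list. length l = Suc n}
        = (\<lambda>(x, l). x # l) ` (UNIV \<times> {l. length l = n})"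
      by (auto simp: length_Suc_conv)
    then have "|{l :: ('a \<times> nat) list. length l = Suc n}|
        \<le>o |(UNIV :: ('a \<times> nat) set) \<times> {l :: ('a \<times> nat) list. length l = n}|"
      by (metis card_of_image)
    then show ?case
      using card_of_Times_ordLeq_infinite_Field[OF inf pairs Suc.IH Card_order]
      by (rule ordLeq_transitive)
  qed
  then have "|\<Union>n\<in>(UNIV :: nat set). {l :: ('a \<times> nat) list. length l = n}| \<le>o \<kappa>"
    using nat inf Card_order by (intro card_of_UNION_ordLeq_infinite_Field) auto
  moreover have "(\<Union>n\<in>(UNIV :: nat set). {l :: ('a \<times> nat) list. length l = n}) = UNIV"
    by auto
  ultimately show ?thesis by simp
qed

text \<open>
  \<open>P\<close> holds on \<open>H\<close> with fewer than \<open>\<kappa>\<close> exceptions.  For \<open>H\<close> of size \<open>\<kappa>\<close> this defines a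
  proper filter that is closed under intersections of fewer than \<open>\<kappa>\<close> sets.
\<close>

definition almost_all :: "'a set \<Rightarrow> ('a \<Rightarrow> bool) \<Rightarrow> bool" where
  "almost_all H P \<longleftrightarrow> small {a \<in> H. \<not> P a}"

lemma almost_all_ball:
  assumes "small I" "\<And>i. i \<in> I \<Longrightarrow> almost_all H (P i)"
  shows "almost_all H (\<lambda>a. \<forall>i\<in>I. P i a)"
proof -
  have "small (\<Union>i\<in>I. {a \<in> H. \<not> P i a})"
    using assms by (intro small_UN) (auto simp: almost_all_def)
  then show ?thesis
    unfolding almost_all_def by (rule small_subset[rotated]) auto
qed

lemma almost_all_all: "(\<And>n :: nat. almost_all H (P n)) \<Longrightarrow> almost_all H (\<lambda>a. \<forall>n. P n a)"
  using almost_all_ball[of "UNIV :: nat set" H P] small_countable[of "UNIV :: nat set"] by simp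

lemma almost_all_conj:
  assumes "almost_all H P" "almost_all H Q"
  shows "almost_all H (\<lambda>a. P a \<and> Q a)"
  using small_Un[OF assms[unfolded almost_all_def]]
  unfolding almost_all_def by (rule small_subset[rotated]) auto

lemma almost_all_ex:
  assumes "|H| =o \<kappa>" "almost_all H P"
  shows "\<exists>a. P a"
proof (rule ccontr)
  assume "\<nexists>a. P a"
  then have "{a \<in> H. \<not> P a} = H"
    by auto
  then show False
    using assms not_small[of H] by (simp only: almost_all_def)
qed

text \<open>
  \<open>g l\<close> is obtained from the identity by iterating the substitutions \<open>a \<mapsto> s a v n\<close> listed in \<open>l\<close>.
  Modulo fewer than \<open>\<kappa>\<close> points of a deciding set, every \<open>g l\<close> is either constant or above any bound.
  For some unbounded \<open>g l\<close> all \<open>g ((v, n) # l)\<close> are constant, and these constants are the values of \<open>h\<close>.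
\<close>

lemma simultaneous_stabilization:
  fixes s :: "'a \<Rightarrow> 'a \<Rightarrow> nat \<Rightarrow> 'a"
  assumes regressive: "\<And>a v n. v \<sqsubset> a \<Longrightarrow> s a v n \<sqsubset> a"
  obtains h where "\<And>X. small X \<Longrightarrow> \<exists>a. \<forall>v\<in>X. v \<sqsubset> a \<and> (\<forall>n. s a v n = h v n)"
proof -
  define g where "g = rec_list (\<lambda>a. a) (\<lambda>(v, n) l g a. s (g a) v n)"
  have g_Nil: "g [] a = a" and g_Cons: "g ((v, n) # l) a = s (g l a) v n" for a v n l
    by (simp_all add: g_def)
  have idx: "|UNIV :: (('a \<times> nat) list \<times> 'a) set| \<le>o \<kappa>"
    using card_of_Times_ordLeq_infinite_Field[of \<kappa> "UNIV :: ('a \<times> nat) list set" "UNIV :: 'a set"]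
      card_lists card_UNIV Card_order infinite_UNIV
    by (simp add: Field_eq_UNIV ordIso_imp_ordLeq)
  obtain H where H: "|H| =o \<kappa>"
    and dec: "\<And>i. small (H \<inter> {a. g (fst i) a = snd i}) \<or> small (H - {a. g (fst i) a = snd i})"
    using deciding_set[OF idx, of "\<lambda>i. {a. g (fst i) a = snd i}"] by blast
  define ae where "ae = almost_all H"
  note ae_ball = almost_all_ball[of _ H, folded ae_def]
    and ae_all = almost_all_all[of H, folded ae_def]
    and ae_conj = almost_all_conj[of H, folded ae_def]
    and ae_ex = almost_all_ex[OF H, folded ae_def]
  have dec': "ae (\<lambda>a. g l a = b) \<or> ae (\<lambda>a. g l a \<noteq> b)" for l b
  proof -
    have "H \<inter> {a. g l a = b} = {a \<in> H. \<not> g l a \<noteq> b}" "H - {a. g l a = b} = {a \<in> H. \<not> g l a = b}"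
      by auto
    then show ?thesis
      using dec[of "(l, b)"] unfolding ae_def almost_all_def by auto
  qed
  define unbdd where "unbdd l \<longleftrightarrow> (\<forall>b. ae (\<lambda>a. b \<sqsubset> g l a))" for l
  have bdd: "\<exists>b. ae (\<lambda>a. g l a = b)" if "\<not> unbdd l" for l
  proof (rule ccontr)
    assume "\<nexists>b. ae (\<lambda>a. g l a = b)"
    then have ne: "ae (\<lambda>a. g l a \<noteq> b)" for b
      using dec' by blast
    have "ae (\<lambda>a. b \<sqsubset> g l a)" for b
    proof -
      have "ae (\<lambda>a. \<forall>c\<in>{c. c \<sqsubset> b} \<union> {b}. g l a \<noteq> c)"
        using ne by (intro ae_ball small_Un small_initial_segment small_countable) auto
      moreover have "(\<forall>c\<in>{c. c \<sqsubset> b} \<union> {b}. g l a \<noteq> c) \<longleftrightarrow> b \<sqsubset> g l a" for a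
        using prec_linear[of b "g l a"] prec_irrefl prec_trans by auto
      ultimately show ?thesis by simp
    qed
    then show False using that by (simp add: unbdd_def)
  qed
  have "unbdd []"
    unfolding unbdd_def
  proof
    fix b
    have "{a \<in> H. \<not> b \<sqsubset> g [] a} \<subseteq> {c. c \<sqsubset> b} \<union> {b}"
      using prec_linear by (auto simp: g_Nil)
    then show "ae (\<lambda>a. b \<sqsubset> g [] a)"
      unfolding ae_def almost_all_def
      by (rule small_subset) (intro small_Un small_initial_segment small_countable, simp)
  qed
  \<comment> \<open>Otherwise some sequence of lists \<open>L k\<close> is unbounded at every stage.  As \<open>v\<close> precedes \<open>g (L k) a\<close> for
    almost all \<open>a\<close>, the map \<open>s\<close> decreases there, and one \<open>a\<close> works for all \<open>k\<close>.\<close>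
  have "\<exists>l. unbdd l \<and> (\<forall>v n. \<not> unbdd ((v, n) # l))"
  proof (rule ccontr)
    assume "\<not> ?thesis"
    then have ext: "\<exists>l' v n. l' = (v, n) # l \<and> unbdd l'" if "unbdd l" for l
      using that by blast
    obtain L where L: "\<And>k. unbdd (L k)" "\<And>k. \<exists>v n. L (Suc k) = (v, n) # L k"
      using dependent_nat_choice[of "\<lambda>_. unbdd" "\<lambda>_ l l'. \<exists>v n. l' = (v, n) # l"]
        \<open>unbdd []\<close> ext by metis
    have "ae (\<lambda>a. g (L (Suc k)) a \<sqsubset> g (L k) a)" for k
    proof -
      obtain v n where "L (Suc k) = (v, n) # L k"
        using L(2) by blast
      moreover have "ae (\<lambda>a. v \<sqsubset> g (L k) a)"
        using L(1) by (simp add: unbdd_def)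
      then have "ae (\<lambda>a. s (g (L k) a) v n \<sqsubset> g (L k) a)"
        unfolding ae_def almost_all_def by (rule small_subset[rotated]) (use regressive in auto)
      ultimately show ?thesis by (simp add: g_Cons)
    qed
    then obtain a where a: "\<And>k. g (L (Suc k)) a \<sqsubset> g (L k) a"
      using ae_ex[OF ae_all[of "\<lambda>k a. g (L (Suc k)) a \<sqsubset> g (L k) a"]] by blast
    then show False
      using wf_prec wf_iff_no_infinite_down_chain[of "{(b, c). b \<sqsubset> c}"]
      by (auto dest: spec[of _ "\<lambda>k. g (L k) a"])
  qed
  then obtain l where l: "unbdd l" "\<And>v n. \<not> unbdd ((v, n) # l)"
    by metis
  have "\<forall>v n. \<exists>b. ae (\<lambda>a. s (g l a) v n = b)"
    using bdd[OF l(2)] unfolding g_Cons by simp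
  then obtain h where h: "\<And>v n. ae (\<lambda>a. s (g l a) v n = h v n)"
    by metis
  have "\<exists>a. \<forall>v\<in>X. v \<sqsubset> a \<and> (\<forall>n. s a v n = h v n)" if "small X" for X
  proof -
    have "ae (\<lambda>a. \<forall>v\<in>X. v \<sqsubset> g l a \<and> (\<forall>n. s (g l a) v n = h v n))"
      using that h l(1) by (intro ae_ball ae_conj ae_all) (auto simp: unbdd_def)
    then show ?thesis using ae_ex by blast
  qed
  then show thesis using that by blast
qed

lemma small_hull:
  fixes h :: "'a \<Rightarrow> nat \<Rightarrow> 'a"
  shows "\<exists>K. small K \<and> v \<in> K \<and> (\<forall>a b. b \<in> K \<longrightarrow> a \<sqsubset> b \<longrightarrow> a \<in> K) \<and> (\<forall>a n. a \<in> K \<longrightarrow> h a n \<in> K)"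
proof -
  define step where "step X = X \<union> (\<Union>x\<in>X. {b. b \<sqsubset> x}) \<union> (\<Union>x\<in>X. range (h x))" for X
  have small_step: "small (step X)" if "small X" for X
    unfolding step_def
    by (intro small_Un small_UN that small_initial_segment small_countable) auto
  define K where "K = (\<Union>k. (step ^^ k) {v})"
  have "small ((step ^^ k) {v})" for k
    by (induction k) (auto intro: small_step small_countable)
  then have "small K"
    unfolding K_def by (intro small_UN) (auto intro: small_countable)
  have step_K: "step ((step ^^ k) {v}) \<subseteq> K" for k
  proof -
    have "(step ^^ Suc k) {v} \<subseteq> K"
      unfolding K_def by blast
    then show ?thesis by simp
  qed
  have "a \<in> K" if "b \<in> K" "a \<sqsubset> b" for a b
  proof -
    obtain k where "b \<in> (step ^^ k) {v}"
      using \<open>b \<in> K\<close> unfolding K_def by blast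
    then have "a \<in> step ((step ^^ k) {v})"
      using \<open>a \<sqsubset> b\<close> unfolding step_def by blast
    then show ?thesis using step_K by blast
  qed
  moreover have "h a n \<in> K" if "a \<in> K" for a n
  proof -
    obtain k where "a \<in> (step ^^ k) {v}"
      using \<open>a \<in> K\<close> unfolding K_def by blast
    then have "h a n \<in> step ((step ^^ k) {v})"
      unfolding step_def by blast
    then show ?thesis using step_K by blast
  qed
  moreover have "v \<in> K"
    unfolding K_def by (rule UN_I[of 0]) auto
  ultimately show ?thesis
    using \<open>small K\<close> by (intro exI[of _ K]) simp
qed

end

section \<open>Ultrametric norms and closed spans\<close>

lemma ultranorm_0: "ultranorm (0 :: 'a :: complete_ultranormed_group) = 0"
  by (simp add: ultranorm_eq_0_iff)

lemma ultranorm_minus: "ultranorm (- x) = ultranorm (x :: 'a :: complete_ultranormed_group)"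
  using dist_commute[of 0 x] by (simp add: dist_ultranorm)

lemma ultranorm_minus_commute:
  "ultranorm (x - y) = ultranorm (y - x :: 'a :: complete_ultranormed_group)"
  using ultranorm_minus[of "x - y"] by simp

lemma ultranorm_add_le:
  "ultranorm (x + y) \<le> max (ultranorm x) (ultranorm (y :: 'a :: complete_ultranormed_group))"
  using ultranorm_diff_le[of x "- y"] by (simp add: ultranorm_minus)

lemma ultranorm_sum_le:
  fixes f :: "'b \<Rightarrow> 'a :: complete_ultranormed_group"
  assumes "0 \<le> r" "\<And>i. i \<in> A \<Longrightarrow> ultranorm (f i) \<le> r"
  shows "ultranorm (sum f A) \<le> r"
  using assms(2)
proof (induction A rule: infinite_finite_induct)
  case (insert i A)
  then have "ultranorm (f i) \<le> r" "ultranorm (sum f A) \<le> r"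
    by auto
  then show ?case
    using insert.hyps ultranorm_add_le[of "f i" "sum f A"] by simp
qed (simp_all add: ultranorm_0 assms(1))

lemma ultranorm_one: "ultranorm (1 :: 'a :: complete_valuation_field) = 1"
  using valuation_mult[of 1 "1 :: 'a"] ultranorm_eq_0_iff[of "1 :: 'a"] by simp

lemma ultranorm_inverse:
  "ultranorm (inverse x) = inverse (ultranorm (x :: 'a :: complete_valuation_field))"
proof (cases "x = 0")
  case False
  then have "ultranorm (inverse x) * ultranorm x = 1"
    by (simp add: valuation_mult[symmetric] ultranorm_one)
  then show ?thesis
    by (metis inverse_unique mult.commute)
qed (simp add: ultranorm_0)

lemma in_closure_ultranorm:
  "x \<in> closure S \<longleftrightarrow> (\<forall>\<epsilon>>0. \<exists>y\<in>S. ultranorm (x - y) < \<epsilon>)"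
  for x :: "'a :: complete_ultranormed_group"
  by (simp add: closure_approachable dist_ultranorm ultranorm_minus_commute)

lemma closure_ultranormD:
  fixes x :: "'a :: complete_ultranormed_group"
  assumes "x \<in> closure S" "\<epsilon> > 0"
  obtains y where "y \<in> S" "ultranorm (x - y) < \<epsilon>"
  using assms unfolding in_closure_ultranorm by auto

lemma has_sum_ultranorm:
  fixes f :: "'b \<Rightarrow> 'a :: complete_ultranormed_group"
  shows "(f has_sum v) E \<longleftrightarrow>
    (\<forall>\<epsilon>>0. \<exists>F0. finite F0 \<and> F0 \<subseteq> E \<and>
      (\<forall>F. finite F \<and> F0 \<subseteq> F \<and> F \<subseteq> E \<longrightarrow> ultranorm (v - sum f F) < \<epsilon>))"
  by (simp add: has_sum_def tendsto_iff eventually_finite_subsets_at_top dist_ultranorm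
      ultranorm_minus_commute[of v])

lemma has_sumD_ultranorm:
  fixes f :: "'b \<Rightarrow> 'a :: complete_ultranormed_group"
  assumes "(f has_sum v) E" "finite G" "G \<subseteq> E" "\<epsilon> > 0"
  obtains F where "finite F" "G \<subseteq> F" "F \<subseteq> E" "ultranorm (v - sum f F) < \<epsilon>"
proof -
  obtain F0 where "finite F0 \<and> F0 \<subseteq> E \<and>
      (\<forall>F. finite F \<and> F0 \<subseteq> F \<and> F \<subseteq> E \<longrightarrow> ultranorm (v - sum f F) < \<epsilon>)"
    using assms(1,4) unfolding has_sum_ultranorm by (elim allE[of _ \<epsilon>] impE exE)
  with assms(2,3) show thesis
    by (intro that[of "F0 \<union> G"]) simp_all
qed

lemma has_sum_ultranorm_diff:
  fixes f g :: "'b \<Rightarrow> 'a :: complete_ultranormed_group"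
  assumes "(f has_sum v) E" "(g has_sum w) E"
  shows "((\<lambda>e. f e - g e) has_sum (v - w)) E"
  unfolding has_sum_ultranorm
proof (intro allI impI)
  fix \<epsilon> :: real assume "\<epsilon> > 0"
  obtain F1 where F1: "finite F1 \<and> F1 \<subseteq> E \<and>
      (\<forall>F. finite F \<and> F1 \<subseteq> F \<and> F \<subseteq> E \<longrightarrow> ultranorm (v - sum f F) < \<epsilon>)"
    using assms(1) \<open>\<epsilon> > 0\<close> unfolding has_sum_ultranorm by (elim allE[of _ \<epsilon>] impE exE)
  obtain F2 where F2: "finite F2 \<and> F2 \<subseteq> E \<and>
      (\<forall>F. finite F \<and> F2 \<subseteq> F \<and> F \<subseteq> E \<longrightarrow> ultranorm (w - sum g F) < \<epsilon>)"
    using assms(2) \<open>\<epsilon> > 0\<close> unfolding has_sum_ultranorm by (elim allE[of _ \<epsilon>] impE exE)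
  have "ultranorm (v - w - (\<Sum>e\<in>F. f e - g e)) < \<epsilon>"
    if F: "finite F" "F1 \<union> F2 \<subseteq> F" "F \<subseteq> E" for F
  proof -
    have eq: "v - w - (\<Sum>e\<in>F. f e - g e) = (v - sum f F) - (w - sum g F)"
      by (simp add: sum_subtractf)
    have "ultranorm (v - sum f F) < \<epsilon>" "ultranorm (w - sum g F) < \<epsilon>"
      using F F1 F2 by simp_all
    then show ?thesis
      unfolding eq by (intro le_less_trans[OF ultranorm_diff_le]) simp
  qed
  then show "\<exists>F0. finite F0 \<and> F0 \<subseteq> E \<and>
      (\<forall>F. finite F \<and> F0 \<subseteq> F \<and> F \<subseteq> E \<longrightarrow> ultranorm (v - w - (\<Sum>e\<in>F. f e - g e)) < \<epsilon>)"
    using F1 F2 by (intro exI[of _ "F1 \<union> F2"]) simp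
qed

lemma C0_bdd_above: "c \<in> C0 E \<Longrightarrow> bdd_above ((\<lambda>e. ultranorm (c e)) ` E)"
proof -
  assume "c \<in> C0 E"
  then have fin: "finite {e \<in> E. ultranorm (c e) \<ge> 1}"
    by (simp add: C0_def)
  have "ultranorm (c e) \<le> max 1 (Max ((\<lambda>e. ultranorm (c e)) ` {e \<in> E. ultranorm (c e) \<ge> 1}))"
    if "e \<in> E" for e
    using fin that by (cases "ultranorm (c e) \<ge> 1") (auto intro!: Max_ge simp: le_max_iff_disj)
  then show ?thesis
    by (intro bdd_aboveI2)
qed

lemma C0_norm_upper: "c \<in> C0 E \<Longrightarrow> e \<in> E \<Longrightarrow> ultranorm (c e) \<le> C0_norm E c"
  unfolding C0_norm_def by (auto intro: cSUP_upper C0_bdd_above)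

lemma C0_norm_least:
  "0 \<le> r \<Longrightarrow> (\<And>e. e \<in> E \<Longrightarrow> ultranorm (c e) \<le> r) \<Longrightarrow> C0_norm E c \<le> r"
  unfolding C0_norm_def by (auto intro: cSUP_least)

lemma C0_norm_nonneg: "c \<in> C0 E \<Longrightarrow> 0 \<le> C0_norm E c"
  using C0_norm_upper ultranorm_nonneg order_trans
  by (metis C0_norm_def all_not_in_conv order_refl)

(* The symbol is reserved for the scalar multiplication of the vector space. *)
no_notation vector_scalar_mult (infixl \<open>*s\<close> 70)

context ultrametric_banach_space
begin

lemma subspace_closure:
  assumes "subspace S"
  shows "subspace (closure S)"
proof (rule subspaceI)
  show "0 \<in> closure S"
    using subspace_0[OF assms] closure_subset by auto
next
  fix x y assume xy: "x \<in> closure S" "y \<in> closure S"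
  show "x + y \<in> closure S"
    unfolding in_closure_ultranorm
  proof (intro allI impI)
    fix \<epsilon> :: real assume "\<epsilon> > 0"
    obtain x' where "x' \<in> S" "ultranorm (x - x') < \<epsilon>"
      by (rule closure_ultranormD[OF xy(1) \<open>\<epsilon> > 0\<close>])
    moreover obtain y' where "y' \<in> S" "ultranorm (y - y') < \<epsilon>"
      by (rule closure_ultranormD[OF xy(2) \<open>\<epsilon> > 0\<close>])
    ultimately show "\<exists>z\<in>S. ultranorm (x + y - z) < \<epsilon>"
      using subspace_add[OF assms] ultranorm_add_le[of "x - x'" "y - y'"]
      by (intro bexI[of _ "x' + y'"]) (auto simp: algebra_simps)
  qed
next
  fix c x assume x: "x \<in> closure S"
  show "c *s x \<in> closure S"
    unfolding in_closure_ultranorm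
  proof (intro allI impI)
    fix \<epsilon> :: real assume "\<epsilon> > 0"
    show "\<exists>z\<in>S. ultranorm (c *s x - z) < \<epsilon>"
    proof (cases "c = 0")
      case True
      with \<open>\<epsilon> > 0\<close> show ?thesis
        using subspace_0[OF assms] by (intro bexI[of _ 0]) (auto simp: ultranorm_0)
    next
      case False
      then have c: "ultranorm c > 0"
        using ultranorm_nonneg[of c] ultranorm_eq_0_iff[of c] by linarith
      with \<open>\<epsilon> > 0\<close> have "\<epsilon> / ultranorm c > 0"
        by simp
      then obtain x' where x': "x' \<in> S" "ultranorm (x - x') < \<epsilon> / ultranorm c"
        by (rule closure_ultranormD[OF x])
      have "c *s x - c *s x' = c *s (x - x')"
        by (simp add: scale_right_diff_distrib)
      then have "ultranorm (c *s x - c *s x') < \<epsilon>"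
        using c x'(2) by (simp only: ultranorm_scale) (simp add: pos_less_divide_eq mult.commute)
      then show ?thesis
        using x'(1) subspace_scale[OF assms] by blast
    qed
  qed
qed

lemma subspace_closed_span: "subspace (closed_span S)"
  unfolding closed_span_def by (intro subspace_closure subspace_span)

lemma closed_closed_span: "closed (closed_span S)"
  by (simp add: closed_span_def)

lemma span_subset_closed_span: "span S \<subseteq> closed_span S"
  by (simp add: closed_span_def closure_subset)

lemma closed_span_superset: "S \<subseteq> closed_span S"
  using span_superset span_subset_closed_span by blast

lemma closed_span_minimal: "S \<subseteq> T \<Longrightarrow> subspace T \<Longrightarrow> closed T \<Longrightarrow> closed_span S \<subseteq> T"
  unfolding closed_span_def by (intro closure_minimal span_minimal)

lemma closed_span_subset: "S \<subseteq> closed_span T \<Longrightarrow> closed_span S \<subseteq> closed_span T"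
  by (intro closed_span_minimal subspace_closed_span closed_closed_span)

lemma closed_span_mono: "S \<subseteq> T \<Longrightarrow> closed_span S \<subseteq> closed_span T"
  using closed_span_superset by (intro closed_span_subset) blast

lemma in_closed_span:
  "x \<in> closed_span S \<longleftrightarrow> (\<forall>\<epsilon>>0. \<exists>y\<in>span S. ultranorm (x - y) < \<epsilon>)"
  by (simp add: closed_span_def in_closure_ultranorm)

lemma closed_spanD:
  assumes "x \<in> closed_span S" "\<epsilon> > 0"
  obtains y where "y \<in> span S" "ultranorm (x - y) < \<epsilon>"
  using assms unfolding in_closed_span by auto

text \<open>
  The span is a union of finitely generated ones, and countably many approximations of a vector suffice.
\<close>

lemma countable_generation:
  assumes "v \<in> closed_span E"
  obtains T where "countable T" "T \<subseteq> E" "v \<in> closed_span T"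
proof -
  have "\<exists>T y. finite T \<and> T \<subseteq> E \<and> y \<in> span T \<and> ultranorm (v - y) < inverse (real (Suc n))" for n
  proof -
    obtain y where y: "y \<in> span E" "ultranorm (v - y) < inverse (real (Suc n))"
      by (rule closed_spanD[OF assms, of "inverse (real (Suc n))"]) auto
    obtain T c where "finite T" "T \<subseteq> E" "y = (\<Sum>a\<in>T. c a *s a)"
      using y(1) unfolding span_explicit by auto
    then show ?thesis
      using y(2) by (intro exI[of _ T] exI[of _ y]) (auto intro: span_sum span_scale span_base)
  qed
  then obtain T y where Ty: "\<And>n. finite (T n)" "\<And>n. T n \<subseteq> E" "\<And>n. y n \<in> span (T n)"
    "\<And>n. ultranorm (v - y n) < inverse (real (Suc n))"
    by metis
  show thesis
  proof
    show "countable (\<Union>n. T n)" "(\<Union>n. T n) \<subseteq> E"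
      using Ty by (auto intro: countable_finite)
    show "v \<in> closed_span (\<Union>n. T n)"
      unfolding in_closed_span
    proof (intro allI impI)
      fix \<epsilon> :: real assume "\<epsilon> > 0"
      then obtain n where "inverse (real (Suc n)) < \<epsilon>"
        using reals_Archimedean by blast
      moreover have "y n \<in> span (\<Union>n. T n)"
        using Ty(3)[of n] span_mono[of "T n" "\<Union>n. T n"] by blast
      ultimately show "\<exists>y\<in>span (\<Union>n. T n). ultranorm (v - y) < \<epsilon>"
        using Ty(4)[of n] less_trans by blast
    qed
  qed
qed

section \<open>Orthonormal sets and Schauder bases\<close>

text \<open>
  The finite part of the definition of an orthonormal Schauder basis.  The reverse inequality
  between coefficients and norm is the ultrametric inequality.
\<close>

definition orthonormal :: "'v set \<Rightarrow> bool" where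
  "orthonormal E \<longleftrightarrow> (\<forall>e\<in>E. ultranorm e = 1) \<and>
    (\<forall>A c. finite A \<and> A \<subseteq> E \<longrightarrow> (\<forall>e\<in>A. ultranorm (c e) \<le> ultranorm (\<Sum>e\<in>A. c e *s e)))"

lemma orthonormalD:
  assumes "orthonormal E" "finite A" "A \<subseteq> E" "e \<in> A"
  shows "ultranorm (c e) \<le> ultranorm (\<Sum>e\<in>A. c e *s e)"
  using assms unfolding orthonormal_def by blast

lemma orthonormal_unit: "orthonormal E \<Longrightarrow> e \<in> E \<Longrightarrow> ultranorm e = 1"
  by (simp add: orthonormal_def)

lemma orthonormal_empty: "orthonormal {}"
  by (auto simp: orthonormal_def)

lemma orthonormal_Union_chain:
  assumes "subset.chain {E. orthonormal E} \<E>"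
  shows "orthonormal (\<Union>\<E>)"
  unfolding orthonormal_def
proof (intro conjI allI impI ballI)
  fix e assume "e \<in> \<Union>\<E>"
  then show "ultranorm e = 1"
    using assms by (auto simp: subset_chain_def orthonormal_def)
next
  fix A c e assume A: "finite A \<and> A \<subseteq> \<Union>\<E>" and "e \<in> A"
  then obtain E where "E \<in> \<E>" "A \<subseteq> E"
    using finite_subset_Union_chain[of A \<E>] assms by blast
  then show "ultranorm (c e) \<le> ultranorm (\<Sum>e\<in>A. c e *s e)"
    using A \<open>e \<in> A\<close> assms by (intro orthonormalD[of E]) (auto simp: subset_chain_def)
qed

lemma ultranorm_sum_orthonormal_le:
  assumes "orthonormal E" "A \<subseteq> E" "0 \<le> r" "\<And>e. e \<in> A \<Longrightarrow> ultranorm (c e) \<le> r"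
  shows "ultranorm (\<Sum>e\<in>A. c e *s e) \<le> r"
  using assms by (intro ultranorm_sum_le) (auto simp: ultranorm_scale dest: orthonormal_unit)

lemma orthonormal_coeff_le:
  assumes "orthonormal E" "((\<lambda>e. c e *s e) has_sum v) E" "e \<in> E"
  shows "ultranorm (c e) \<le> ultranorm v"
proof (rule ccontr)
  assume "\<not> ?thesis"
  then have less: "ultranorm v < ultranorm (c e)" by simp
  then have "ultranorm (c e) > 0"
    using ultranorm_nonneg[of v] by linarith
  then obtain F where F: "finite F" "{e} \<subseteq> F" "F \<subseteq> E" "ultranorm (v - (\<Sum>e\<in>F. c e *s e)) < ultranorm (c e)"
    using has_sumD_ultranorm[OF assms(2), of "{e}"] assms(3) by auto
  have "ultranorm (c e) \<le> ultranorm (\<Sum>e\<in>F. c e *s e)"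
    using F assms(1) by (intro orthonormalD) auto
  then show False
    using less F(4) ultranorm_diff_le[of v "v - (\<Sum>e\<in>F. c e *s e)"] by simp
qed

lemma orthonormal_sum_le:
  assumes "orthonormal E" "((\<lambda>e. c e *s e) has_sum v) E"
    and "0 \<le> r" "\<And>e. e \<in> E \<Longrightarrow> ultranorm (c e) \<le> r"
  shows "ultranorm v \<le> r"
proof (rule ccontr)
  assume less: "\<not> ?thesis"
  with assms(3) have "ultranorm v > 0" by linarith
  then obtain F where F: "finite F" "F \<subseteq> E" "ultranorm (v - (\<Sum>e\<in>F. c e *s e)) < ultranorm v"
    using has_sumD_ultranorm[OF assms(2), of "{}"] by auto
  have "ultranorm (\<Sum>e\<in>F. c e *s e) \<le> r"
    using F assms by (intro ultranorm_sum_orthonormal_le[of E]) auto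
  then show False
    using less F(3) ultranorm_add_le[of "v - (\<Sum>e\<in>F. c e *s e)" "\<Sum>e\<in>F. c e *s e"] by simp
qed

lemma orthonormal_convergent:
  assumes "orthonormal E" "c \<in> C0 E"
  obtains v where "((\<lambda>e. c e *s e) has_sum v) E"
proof -
  define F where "F n = {e \<in> E. ultranorm (c e) \<ge> inverse (real (Suc n))}" for n
  define s where "s n = (\<Sum>e\<in>F n. c e *s e)" for n
  have fin: "finite (F n)" and FE: "F n \<subseteq> E" for n
    using assms(2) by (auto simp: F_def C0_def)
  have close: "ultranorm ((\<Sum>e\<in>G. c e *s e) - s n) \<le> inverse (real (Suc n))"
    if "finite G" "F n \<subseteq> G" "G \<subseteq> E" for G n
  proof -
    have "(\<Sum>e\<in>G. c e *s e) - s n = (\<Sum>e\<in>G - F n. c e *s e)"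
      using that by (simp add: s_def sum_diff)
    also have "ultranorm \<dots> \<le> inverse (real (Suc n))"
      using that assms(1) by (intro ultranorm_sum_orthonormal_le[of E]) (auto simp: F_def)
    finally show ?thesis .
  qed
  have mono: "F n \<subseteq> F m" if "n \<le> m" for n m
  proof -
    have "inverse (real (Suc m)) \<le> inverse (real (Suc n))"
      using that by (simp add: field_simps)
    then show ?thesis unfolding F_def by (blast intro: order_trans)
  qed
  have "Cauchy s"
  proof (rule metric_CauchyI)
    fix \<epsilon> :: real assume "\<epsilon> > 0"
    then obtain N where N: "inverse (real (Suc N)) < \<epsilon>"
      using reals_Archimedean by blast
    have s_N: "ultranorm (s n - s N) < \<epsilon>" if "n \<ge> N" for n
      using close[OF fin mono[OF that] FE] N by (auto simp: s_def)
    have "dist (s m) (s n) < \<epsilon>" if "m \<ge> N" "n \<ge> N" for m n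
      using ultranorm_diff_le[of "s m - s N" "s n - s N"] s_N[OF that(1)] s_N[OF that(2)]
      by (simp add: dist_ultranorm)
    then show "\<exists>M. \<forall>m\<ge>M. \<forall>n\<ge>M. dist (s m) (s n) < \<epsilon>" by blast
  qed
  then obtain v where v: "s \<longlonglongrightarrow> v"
    using Cauchy_convergent convergent_def by blast
  have "((\<lambda>e. c e *s e) has_sum v) E"
    unfolding has_sum_ultranorm
  proof (intro allI impI)
    fix \<epsilon> :: real assume "\<epsilon> > 0"
    then obtain n0 where n0: "inverse (real (Suc n0)) < \<epsilon>"
      using reals_Archimedean by blast
    obtain n1 where n1: "\<And>n. n \<ge> n1 \<Longrightarrow> dist (s n) v < \<epsilon>"
      using v \<open>\<epsilon> > 0\<close> unfolding lim_sequentially by blast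
    define n where "n = max n0 n1"
    have n: "inverse (real (Suc n)) < \<epsilon>"
      using n0 by (rule le_less_trans[rotated]) (simp add: n_def field_simps)
    have "ultranorm (v - (\<Sum>e\<in>G. c e *s e)) < \<epsilon>" if "finite G" "F n \<subseteq> G" "G \<subseteq> E" for G
      using close[OF that] n n1[of n] ultranorm_diff_le[of "v - s n" "(\<Sum>e\<in>G. c e *s e) - s n"]
      by (simp add: n_def dist_ultranorm ultranorm_minus_commute[of v])
    then show "\<exists>F0. finite F0 \<and> F0 \<subseteq> E \<and>
        (\<forall>G. finite G \<and> F0 \<subseteq> G \<and> G \<subseteq> E \<longrightarrow> ultranorm (v - (\<Sum>e\<in>G. c e *s e)) < \<epsilon>)"
      using fin[of n] FE[of n] by (intro exI[of _ "F n"]) simp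
  qed
  with that show thesis .
qed

lemma orthonormal_independent:
  assumes "orthonormal E"
  shows "independent E"
proof
  assume "dependent E"
  then obtain A c where A: "finite A" "A \<subseteq> E" "(\<Sum>e\<in>A. c e *s e) = 0" and "\<exists>e\<in>A. c e \<noteq> 0"
    unfolding dependent_explicit by blast
  then obtain e where e: "e \<in> A" "c e \<noteq> 0" by blast
  have "ultranorm (c e) \<le> 0"
    using orthonormalD[OF assms A(1,2) e(1), of c] A(3) by (simp add: ultranorm_0)
  then show False
    using e(2) ultranorm_nonneg[of "c e"] ultranorm_eq_0_iff[of "c e"] by simp
qed

lemma representation_le:
  assumes "orthonormal E" "u \<in> span E"
  shows "ultranorm (representation E u e) \<le> ultranorm u"
proof (cases "representation E u e = 0")
  case True
  then show ?thesis by (simp add: ultranorm_0 ultranorm_nonneg)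
next
  case False
  note ind = orthonormal_independent[OF assms(1)]
  let ?A = "{e. representation E u e \<noteq> 0}"
  have "ultranorm (representation E u e) \<le> ultranorm (\<Sum>e\<in>?A. representation E u e *s e)"
    using False representation_ne_zero finite_representation
    by (intro orthonormalD[OF assms(1)]) auto
  then show ?thesis
    using sum_nonzero_representation_eq[OF ind assms(2)] by simp
qed

text \<open>
  The coefficients of \<open>v\<close> are the limits of those of vectors in \<open>span E\<close> approximating \<open>v\<close>, which
  are Cauchy sequences since coefficients are bounded by the norm.
\<close>

lemma orthonormal_expansion:
  assumes "orthonormal E" "v \<in> closed_span E"
  obtains c where "c \<in> C0 E" "((\<lambda>e. c e *s e) has_sum v) E"
proof -
  note ind = orthonormal_independent[OF assms(1)]
  have "\<exists>u\<in>span E. ultranorm (v - u) < inverse (real (Suc n))" for n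
    using assms(2) unfolding in_closed_span by simp
  then obtain u where u: "\<And>n. u n \<in> span E" "\<And>n. ultranorm (v - u n) < inverse (real (Suc n))"
    by metis
  define r where "r n = representation E (u n)" for n
  have r_diff: "ultranorm (r m e - r n e) < max (inverse (real (Suc m))) (inverse (real (Suc n)))"
    for m n e
  proof -
    have "r m e - r n e = representation E (u m - u n) e"
      by (simp add: r_def representation_diff[OF ind u(1) u(1)])
    then have "ultranorm (r m e - r n e) \<le> ultranorm (u m - u n)"
      using representation_le[OF assms(1)] u(1) by (simp add: span_diff)
    then show ?thesis
      using ultranorm_diff_le[of "v - u n" "v - u m"] u(2)[of m] u(2)[of n] by simp
  qed
  have "Cauchy (\<lambda>n. r n e)" for e
  proof (rule metric_CauchyI)
    fix \<epsilon> :: real assume "\<epsilon> > 0"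
    then obtain N where N: "inverse (real (Suc N)) < \<epsilon>"
      using reals_Archimedean by blast
    have "inverse (real (Suc n)) < \<epsilon>" if "n \<ge> N" for n
      using N by (rule le_less_trans[rotated]) (use that in \<open>simp add: field_simps\<close>)
    then have "dist (r m e) (r n e) < \<epsilon>" if "m \<ge> N" "n \<ge> N" for m n
      unfolding dist_ultranorm using that by (intro less_trans[OF r_diff]) simp
    then show "\<exists>M. \<forall>m\<ge>M. \<forall>n\<ge>M. dist (r m e) (r n e) < \<epsilon>" by blast
  qed
  then obtain c where c: "\<And>e. (\<lambda>n. r n e) \<longlonglongrightarrow> c e"
    unfolding Cauchy_convergent_iff convergent_def by metis
  have c_r: "ultranorm (c e - r n e) \<le> inverse (real (Suc n))" for e n
  proof -
    obtain n1 where n1: "\<And>m. m \<ge> n1 \<Longrightarrow> dist (r m e) (c e) < inverse (real (Suc n))"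
      using c[of e] unfolding lim_sequentially by (metis inverse_positive_iff_positive of_nat_0_less_iff zero_less_Suc)
    define m where "m = max n n1"
    have "inverse (real (Suc m)) \<le> inverse (real (Suc n))"
      by (simp add: m_def field_simps)
    then have "ultranorm (r m e - r n e) < inverse (real (Suc n))"
      using r_diff[of m e n] by simp
    then show ?thesis
      using n1[of m] ultranorm_diff_le[of "r m e - r n e" "r m e - c e"]
      by (simp add: m_def dist_ultranorm)
  qed
  have fin: "finite {e. r n e \<noteq> 0}" and sub: "{e. r n e \<noteq> 0} \<subseteq> E" for n
    unfolding r_def by (auto intro: finite_representation representation_ne_zero)
  show thesis
  proof
    show "c \<in> C0 E"
      unfolding C0_def
    proof (intro CollectI allI impI)
      fix \<epsilon> :: real assume "\<epsilon> > 0"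
      then obtain n where n: "inverse (real (Suc n)) < \<epsilon>"
        using reals_Archimedean by blast
      have "r n e \<noteq> 0" if "ultranorm (c e) \<ge> \<epsilon>" for e
        using c_r[of e n] that n by auto
      then show "finite {e \<in> E. \<epsilon> \<le> ultranorm (c e)}"
        by (intro finite_subset[OF _ fin[of n]]) auto
    qed
    show "((\<lambda>e. c e *s e) has_sum v) E"
      unfolding has_sum_ultranorm
    proof (intro allI impI)
      fix \<epsilon> :: real assume "\<epsilon> > 0"
      then obtain n where n: "inverse (real (Suc n)) < \<epsilon>"
        using reals_Archimedean by blast
      have "ultranorm (v - (\<Sum>e\<in>G. c e *s e)) < \<epsilon>"
        if G: "finite G" "{e. r n e \<noteq> 0} \<subseteq> G" "G \<subseteq> E" for G
      proof -
        have "u n = (\<Sum>e\<in>{e. r n e \<noteq> 0}. r n e *s e)"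
          using sum_nonzero_representation_eq[OF ind u(1)] by (simp add: r_def)
        also have "\<dots> = (\<Sum>e\<in>G. r n e *s e)"
          using G by (intro sum.mono_neutral_left) auto
        finally have "(\<Sum>e\<in>G. c e *s e) - u n = (\<Sum>e\<in>G. (c e - r n e) *s e)"
          by (simp add: sum_subtractf scale_left_diff_distrib)
        also have "ultranorm \<dots> \<le> inverse (real (Suc n))"
          using G assms(1) c_r by (intro ultranorm_sum_orthonormal_le[of E]) auto
        finally show ?thesis
          using n u(2)[of n] ultranorm_diff_le[of "v - u n" "(\<Sum>e\<in>G. c e *s e) - u n"] by simp
      qed
      then show "\<exists>F0. finite F0 \<and> F0 \<subseteq> E \<and>
          (\<forall>G. finite G \<and> F0 \<subseteq> G \<and> G \<subseteq> E \<longrightarrow> ultranorm (v - (\<Sum>e\<in>G. c e *s e)) < \<epsilon>)"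
        using fin[of n] sub[of n] by (intro exI[of _ "{e. r n e \<noteq> 0}"]) simp
    qed
  qed
qed

lemma orthonormal_Schauder_basisI:
  assumes "orthonormal E" "closed_span E = W"
  shows "orthonormal_Schauder_basis W E"
  unfolding orthonormal_Schauder_basis_def
proof (intro conjI ballI)
  show "E \<subseteq> W"
    using assms(2) closed_span_superset by blast
next
  fix e assume "e \<in> E"
  then show "ultranorm e = 1"
    by (rule orthonormal_unit[OF assms(1)])
next
  fix c :: "'v \<Rightarrow> 'k" assume c: "c \<in> C0 E"
  then obtain v where v: "((\<lambda>e. c e *s e) has_sum v) E"
    using orthonormal_convergent[OF assms(1)] by blast
  have "ultranorm v \<le> C0_norm E c"
    using c by (intro orthonormal_sum_le[OF assms(1) v] C0_norm_upper C0_norm_nonneg)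
  moreover have "C0_norm E c \<le> ultranorm v"
    by (intro C0_norm_least ultranorm_nonneg orthonormal_coeff_le[OF assms(1) v])
  ultimately show "\<exists>v. ((\<lambda>e. c e *s e) has_sum v) E \<and> ultranorm v = C0_norm E c"
    using v by force
next
  fix v assume "v \<in> W"
  then show "\<exists>c\<in>C0 E. ((\<lambda>e. c e *s e) has_sum v) E"
    using orthonormal_expansion[OF assms(1)] assms(2) by blast
qed

lemma orthonormal_Schauder_basisD:
  assumes "orthonormal_Schauder_basis W E"
  shows "orthonormal E" "W \<subseteq> closed_span E"
proof -
  show "orthonormal E"
    unfolding orthonormal_def
  proof (intro conjI allI impI ballI)
    fix e assume "e \<in> E"
    then show "ultranorm e = 1"
      using assms by (simp add: orthonormal_Schauder_basis_def)
  next
    fix A e and c :: "'v \<Rightarrow> 'k" assume A: "finite A \<and> A \<subseteq> E" and "e \<in> A"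
    define c' where "c' e = (if e \<in> A then c e else 0)" for e
    have "{e \<in> E. \<epsilon> \<le> ultranorm (c' e)} \<subseteq> A" if "\<epsilon> > 0" for \<epsilon>
      using that by (auto simp: c'_def ultranorm_0)
    then have c': "c' \<in> C0 E"
      using A unfolding C0_def by (blast intro: finite_subset)
    have "\<forall>c\<in>C0 E. \<exists>v. ((\<lambda>e. c e *s e) has_sum v) E \<and> ultranorm v = C0_norm E c"
      using assms by (simp add: orthonormal_Schauder_basis_def)
    then obtain v where v: "((\<lambda>e. c' e *s e) has_sum v) E" "ultranorm v = C0_norm E c'"
      using c' by (elim ballE exE) auto
    have "v = (\<Sum>e\<in>A. c e *s e)"
    proof (rule ccontr)
      assume "v \<noteq> (\<Sum>e\<in>A. c e *s e)"
      then have "ultranorm (v - (\<Sum>e\<in>A. c e *s e)) > 0"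
        using ultranorm_nonneg[of "v - (\<Sum>e\<in>A. c e *s e)"]
          ultranorm_eq_0_iff[of "v - (\<Sum>e\<in>A. c e *s e)"] by simp
      then obtain F where F: "finite F" "A \<subseteq> F" "F \<subseteq> E"
        "ultranorm (v - (\<Sum>e\<in>F. c' e *s e)) < ultranorm (v - (\<Sum>e\<in>A. c e *s e))"
        by (rule has_sumD_ultranorm[OF v(1) conjunct1[OF A] conjunct2[OF A]])
      have "(\<Sum>e\<in>F. c' e *s e) = (\<Sum>e\<in>A. c e *s e)"
        using F by (intro sum.mono_neutral_cong_right) (auto simp: c'_def)
      with F(4) show False by simp
    qed
    moreover have "ultranorm (c' e) \<le> C0_norm E c'"
      using c' A \<open>e \<in> A\<close> by (intro C0_norm_upper) auto
    ultimately show "ultranorm (c e) \<le> ultranorm (\<Sum>e\<in>A. c e *s e)"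
      using v(2) \<open>e \<in> A\<close> by (simp add: c'_def)
  qed
  show "W \<subseteq> closed_span E"
  proof
    fix v assume "v \<in> W"
    moreover have "\<forall>v\<in>W. \<exists>c\<in>C0 E. ((\<lambda>e. c e *s e) has_sum v) E"
      using assms by (simp add: orthonormal_Schauder_basis_def)
    ultimately obtain c where c: "((\<lambda>e. c e *s e) has_sum v) E"
      by blast
    show "v \<in> closed_span E"
      unfolding in_closed_span
    proof (intro allI impI)
      fix \<epsilon> :: real assume "\<epsilon> > 0"
      then obtain F where "finite F" "F \<subseteq> E" "ultranorm (v - (\<Sum>e\<in>F. c e *s e)) < \<epsilon>"
        using has_sumD_ultranorm[OF c, of "{}"] by auto
      then show "\<exists>y\<in>span E. ultranorm (v - y) < \<epsilon>"
        by (intro bexI[of _ "\<Sum>e\<in>F. c e *s e"]) (auto intro: span_sum span_scale span_base)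
    qed
  qed
qed

lemma free_closed_span_iff:
  "free (closed_span S) \<longleftrightarrow> (\<exists>E. orthonormal E \<and> closed_span E = closed_span S)"
proof
  assume "free (closed_span S)"
  then obtain E where E: "orthonormal_Schauder_basis (closed_span S) E"
    by (auto simp: free_def)
  then have "E \<subseteq> closed_span S"
    by (simp add: orthonormal_Schauder_basis_def)
  then have "closed_span E = closed_span S"
    using orthonormal_Schauder_basisD[OF E] closed_span_subset by (intro equalityI)
  then show "\<exists>E. orthonormal E \<and> closed_span E = closed_span S"
    using orthonormal_Schauder_basisD[OF E] by blast
next
  assume "\<exists>E. orthonormal E \<and> closed_span E = closed_span S"
  then show "free (closed_span S)"
    unfolding free_def using orthonormal_Schauder_basisI by blast
qed

text \<open>
  The coefficient bound survives the addition of a vector from the closed span of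
  the remaining basis vectors.
\<close>

lemma orthonormal_closed_span_le:
  assumes "orthonormal E" "finite A" "A \<subseteq> E" "B \<subseteq> E" "A \<inter> B = {}" "u \<in> closed_span B" "e \<in> A"
  shows "ultranorm (c e) \<le> ultranorm (u + (\<Sum>e\<in>A. c e *s e))"
proof (rule ccontr)
  assume less: "\<not> ?thesis"
  then have "ultranorm (c e) > 0"
    using ultranorm_nonneg[of "u + (\<Sum>e\<in>A. c e *s e)"] by linarith
  then obtain u' where u': "u' \<in> span B" "ultranorm (u - u') < ultranorm (c e)"
    by (rule closed_spanD[OF assms(6)])
  obtain T d where T: "finite T" "T \<subseteq> B" "u' = (\<Sum>e\<in>T. d e *s e)"
    using u'(1) unfolding span_explicit by auto
  define d' where "d' e = (if e \<in> A then c e else d e)" for e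
  have "(\<Sum>e\<in>T \<union> A. d' e *s e) = (\<Sum>e\<in>T. d' e *s e) + (\<Sum>e\<in>A. d' e *s e)"
    using T assms(2,5) by (intro sum.union_disjoint) auto
  also have "(\<Sum>e\<in>T. d' e *s e) = u'"
    unfolding T(3) using T(2) assms(5) by (intro sum.cong) (auto simp: d'_def)
  also have "(\<Sum>e\<in>A. d' e *s e) = (\<Sum>e\<in>A. c e *s e)"
    by (simp add: d'_def)
  finally have "ultranorm (d' e) \<le> ultranorm (u' + (\<Sum>e\<in>A. c e *s e))"
    using orthonormalD[OF assms(1), of "T \<union> A" e d'] T assms by auto
  moreover have "u' + (\<Sum>e\<in>A. c e *s e) = (u + (\<Sum>e\<in>A. c e *s e)) - (u - u')"
    by simp
  ultimately show False
    using u'(2) less assms(7) ultranorm_diff_le[of "u + (\<Sum>e\<in>A. c e *s e)" "u - u'"]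
    by (auto simp: d'_def)
qed

end

section \<open>Almost free spaces of weakly compact rank are free\<close>

text \<open>
  The vectors themselves are well-ordered by a weakly compact cardinal.
\<close>

locale weakly_compact_banach_space =
  ultrametric_banach_space scale + weakly_compact_order \<kappa>
  for scale :: "'k :: complete_valuation_field \<Rightarrow> 'v :: complete_ultranormed_group \<Rightarrow> 'v"
      (infixr \<open>*s\<close> 75)
    and \<kappa> :: "'v rel"
begin

text \<open>
  A predecessor \<open>v\<close> of \<open>a\<close> depends on countably many elements \<open>T\<close> of \<open>E\<close>, and these on
  countably many predecessors of \<open>a\<close>, enumerated by \<open>s\<close>.
\<close>

lemma countable_dependence:
  assumes E: "closed_span E = closed_span {b. b \<sqsubset> a}" and "v \<sqsubset> a"
  shows "\<exists>T s. T \<subseteq> E \<and> v \<in> closed_span T \<and> T \<subseteq> closed_span (range s) \<and> (\<forall>n :: nat. s n \<sqsubset> a)"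
proof -
  have E_sup: "{b. b \<sqsubset> a} \<subseteq> closed_span E" and E_sub: "E \<subseteq> closed_span {b. b \<sqsubset> a}"
    using closed_span_superset[of E] closed_span_superset[of "{b. b \<sqsubset> a}"] E by simp_all
  have "v \<in> closed_span E"
    using E_sup \<open>v \<sqsubset> a\<close> by blast
  then obtain T where T: "countable T" "T \<subseteq> E" "v \<in> closed_span T"
    by (rule countable_generation)
  have "\<exists>S. countable S \<and> S \<subseteq> {b. b \<sqsubset> a} \<and> t \<in> closed_span S" if "t \<in> T" for t
  proof -
    have "t \<in> closed_span {b. b \<sqsubset> a}"
      using E_sub that T(2) by blast
    then obtain S where "countable S" "S \<subseteq> {b. b \<sqsubset> a}" "t \<in> closed_span S"
      by (rule countable_generation)
    then show ?thesis by blast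
  qed
  then obtain S where S: "\<And>t. t \<in> T \<Longrightarrow> countable (S t)" "\<And>t. t \<in> T \<Longrightarrow> S t \<subseteq> {b. b \<sqsubset> a}"
    "\<And>t. t \<in> T \<Longrightarrow> t \<in> closed_span (S t)"
    by metis
  define S' where "S' = insert v (\<Union>t\<in>T. S t)"
  have S': "countable S'" "S' \<noteq> {}" "S' \<subseteq> {b. b \<sqsubset> a}"
    using S(1,2) T(1) \<open>v \<sqsubset> a\<close> by (auto simp: S'_def)
  have "t \<in> closed_span S'" if "t \<in> T" for t
    using S(3)[OF that] closed_span_mono[of "S t" S'] that by (auto simp: S'_def)
  moreover have range: "range (from_nat_into S') = S'"
    using S'(1,2) by (rule range_from_nat_into[rotated])
  moreover have "from_nat_into S' n \<sqsubset> a" for n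
    using S'(3) from_nat_into[OF S'(2), of n] by blast
  ultimately show ?thesis
    using T(2,3) by (intro exI[of _ T] exI[of _ "from_nat_into S'"]) auto
qed

lemma free_if_cardinal_free:
  assumes "cardinal_free \<kappa> UNIV"
  shows "free UNIV"
proof -
  have "\<exists>E. orthonormal E \<and> closed_span E = closed_span {b. b \<sqsubset> a}" for a
    using assms small_initial_segment[of a] unfolding cardinal_free_def free_closed_span_iff[symmetric]
    by blast
  then obtain E where E: "\<And>a. orthonormal (E a)" "\<And>a. closed_span (E a) = closed_span {b. b \<sqsubset> a}"
    by metis
  have "\<forall>a v. \<exists>T s. v \<sqsubset> a \<longrightarrow>
      T \<subseteq> E a \<and> v \<in> closed_span T \<and> T \<subseteq> closed_span (range s) \<and> (\<forall>n :: nat. s n \<sqsubset> a)"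
    using countable_dependence[OF E(2)] by blast
  then obtain T s where Ts: "\<And>a v. v \<sqsubset> a \<Longrightarrow> T a v \<subseteq> E a \<and> v \<in> closed_span (T a v) \<and>
      T a v \<subseteq> closed_span (range (s a v)) \<and> (\<forall>n :: nat. s a v n \<sqsubset> a)"
    by metis
  obtain h where "\<And>X. small X \<Longrightarrow> \<exists>a. \<forall>v\<in>X. v \<sqsubset> a \<and> (\<forall>n. s a v n = h v n)"
    using simultaneous_stabilization[of s] Ts by blast
  then obtain f where f: "\<And>X v. small X \<Longrightarrow> v \<in> X \<Longrightarrow> v \<sqsubset> f X \<and> (\<forall>n. s (f X) v n = h v n)"
    by metis
  \<comment> \<open>One basis \<open>E (f X)\<close> contains bases of the closed spans of all \<open>h\<close>-closed subsets of \<open>X\<close>.\<close>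
  have split: "closed_span (E (f X) \<inter> closed_span K) = closed_span K"
    if X: "small X" "K \<subseteq> X" and K: "\<And>v n. v \<in> K \<Longrightarrow> h v n \<in> K" for X K
  proof (intro equalityI closed_span_subset subsetI)
    fix v assume "v \<in> K"
    then have v: "v \<sqsubset> f X" "s (f X) v = h v"
      using f[OF X(1), of v] X(2) by auto
    have "closed_span (range (h v)) \<subseteq> closed_span K"
      using K[OF \<open>v \<in> K\<close>] by (intro closed_span_mono) auto
    then have "T (f X) v \<subseteq> E (f X) \<inter> closed_span K"
      using Ts[OF v(1)] v(2) by auto
    then show "v \<in> closed_span (E (f X) \<inter> closed_span K)"
      using Ts[OF v(1)] closed_span_mono by blast
  qed auto
  \<comment> \<open>The filtration by initial segments closed under \<open>h\<close>: \<open>C v\<close> is the least one containing \<open>v\<close>, and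
    \<open>Base K\<close> is the union of the segments \<open>C w\<close> strictly below \<open>K\<close>.\<close>
  define closed_set where
    "closed_set K \<longleftrightarrow> (\<forall>a b. b \<in> K \<longrightarrow> a \<sqsubset> b \<longrightarrow> a \<in> K) \<and> (\<forall>a n. a \<in> K \<longrightarrow> h a n \<in> K)" for K
  define C where "C v = \<Inter>{K. closed_set K \<and> v \<in> K}" for v
  have C_closed: "closed_set (C v)" and C_self: "v \<in> C v" for v
    unfolding C_def closed_set_def by blast+
  have C_least: "C v \<subseteq> K" if "closed_set K" "v \<in> K" for v K
    unfolding C_def using that by blast
  have C_mem: "C w \<subseteq> C v" if "w \<in> C v" for v w
    using C_least[OF C_closed that] .
  have C_less: "C w \<subseteq> C v" if "w \<sqsubset> v" for v w
    using C_mem C_closed C_self that unfolding closed_set_def by blast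
  have C_linear: "C v \<subseteq> C w \<or> C w \<subseteq> C v" for v w
    using prec_linear[of v w] C_less by blast
  have C_small: "small (C v)" for v
  proof -
    obtain K where "small K" "v \<in> K" "closed_set K"
      using small_hull[of v h] unfolding closed_set_def by auto
    then have "C v \<subseteq> K"
      by (intro C_least)
    then show ?thesis
      using \<open>small K\<close> by (rule small_subset)
  qed
  define Base where "Base K = (\<Union>w\<in>{w. C w \<subset> K}. C w)" for K
  \<comment> \<open>The new basis vectors in the step from \<open>Base K\<close> to \<open>K\<close>.\<close>
  define F where "F K = (E (f K) \<inter> closed_span K) - closed_span (Base K)" for K
  have split_C: "closed_span (E (f (C v)) \<inter> closed_span (C v)) = closed_span (C v)" for v
    using C_small C_closed[of v] by (intro split) (auto simp: closed_set_def)
  have split_Base: "closed_span (E (f (C v)) \<inter> closed_span (Base (C v))) = closed_span (Base (C v))" for v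
    using C_small
  proof (rule split)
    show "Base (C v) \<subseteq> C v"
      unfolding Base_def by blast
    fix w n assume "w \<in> Base (C v)"
    then obtain w' where w': "w \<in> C w'" "C w' \<subset> C v"
      by (auto simp: Base_def)
    then have "h w n \<in> C w'"
      using C_closed[of w'] by (simp add: closed_set_def)
    then show "h w n \<in> Base (C v)"
      using w'(2) by (auto simp: Base_def)
  qed
  let ?B = "\<Union>K\<in>range C. F K"
  have "ultranorm (c e) \<le> ultranorm (\<Sum>e\<in>A. c e *s e)"
    if "finite A" "A \<subseteq> ?B" "e \<in> A" for A c e
    using that
  proof (induction "card A" arbitrary: A e rule: less_induct)
    case less
    then have "\<forall>e\<in>A. \<exists>v. e \<in> F (C v)" by blast
    then obtain k where k: "\<And>e. e \<in> A \<Longrightarrow> e \<in> F (C (k e))"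
      by metis
    have "finite ((\<lambda>e. C (k e)) ` A)" "(\<lambda>e. C (k e)) ` A \<noteq> {}"
      using less.prems by auto
    then have "\<exists>e0\<in>A. \<forall>e\<in>A. C (k e0) \<subseteq> C (k e) \<longrightarrow> C (k e0) = C (k e)"
      using finite_has_maximal[of "(\<lambda>e. C (k e)) ` A"] by simp
    then obtain e0 where e0: "e0 \<in> A" "\<And>e. e \<in> A \<Longrightarrow> C (k e0) \<subseteq> C (k e) \<Longrightarrow> C (k e0) = C (k e)"
      by blast
    define v where "v = k e0"
    \<comment> \<open>\<open>A1\<close> consists of the vectors from the highest step; the others lie in the closed span of its base.\<close>
    define A1 where "A1 = {e \<in> A. C (k e) = C v}"
    define A2 where "A2 = A - A1"
    have A: "finite A1" "finite A2" "A = A2 \<union> A1" "A2 \<inter> A1 = {}" "e0 \<in> A1"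
      using less.prems(1) e0(1) by (auto simp: A1_def A2_def v_def)
    have A1: "A1 \<subseteq> F (C v)"
    proof
      fix e assume "e \<in> A1"
      then show "e \<in> F (C v)"
        using k[of e] by (simp add: A1_def)
    qed
    have below: "C (k e) \<subset> C v" if "e \<in> A2" for e
      using that e0(2)[of e] C_linear[of "k e0" "k e"] by (auto simp: A1_def A2_def v_def)
    have A2: "A2 \<subseteq> closed_span (Base (C v))"
    proof
      fix e assume e: "e \<in> A2"
      have "C (k e) \<subseteq> Base (C v)"
        using below[OF e] by (auto simp: Base_def)
      moreover have "e \<in> closed_span (C (k e))"
        using k[of e] e by (simp add: F_def A2_def)
      ultimately show "e \<in> closed_span (Base (C v))"
        using closed_span_mono by blast
    qed
    define u where "u = (\<Sum>e\<in>A2. c e *s e)"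
    have sum: "(\<Sum>e\<in>A. c e *s e) = u + (\<Sum>e\<in>A1. c e *s e)"
      unfolding A(3) u_def using A by (intro sum.union_disjoint)
    have u: "u \<in> closed_span (E (f (C v)) \<inter> closed_span (Base (C v)))"
      unfolding split_Base u_def using A2 subspace_closed_span
      by (intro subspace_sum subspace_scale) auto
    have le: "ultranorm (c e) \<le> ultranorm (\<Sum>e\<in>A. c e *s e)" if "e \<in> A1" for e
      unfolding sum
      by (rule orthonormal_closed_span_le[OF E(1) A(1) _ _ _ u that]) (use A1 in \<open>auto simp: F_def\<close>)
    have "ultranorm (\<Sum>e\<in>A1. c e *s e) \<le> ultranorm (\<Sum>e\<in>A. c e *s e)"
      using A1 le by (intro ultranorm_sum_orthonormal_le[OF E(1)[of "f (C v)"]] ultranorm_nonneg) (auto simp: F_def)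
    then have "ultranorm u \<le> ultranorm (\<Sum>e\<in>A. c e *s e)"
      using ultranorm_diff_le[of "\<Sum>e\<in>A. c e *s e" "\<Sum>e\<in>A1. c e *s e"] by (simp add: sum)
    moreover have "ultranorm (c e) \<le> ultranorm u" if "e \<in> A2"
      unfolding u_def
    proof (rule less.hyps[OF _ A(2) _ that])
      have "A2 \<subset> A"
        using A by blast
      then show "card A2 < card A"
        using less.prems(1) by (intro psubset_card_mono)
      show "A2 \<subseteq> ?B"
        using less.prems(2) A(3) by blast
    qed
    ultimately show ?case
      using le less.prems(3) A(3) by fastforce
  qed
  moreover have "ultranorm e = 1" if "e \<in> ?B" for e
    using that orthonormal_unit[OF E(1)] by (auto simp: F_def)
  ultimately have "orthonormal ?B"
    unfolding orthonormal_def by blast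
  moreover have "v \<in> closed_span ?B" for v
  proof (induction v rule: wfp_induct_rule[OF wfP_prec])
    case (1 v)
    have "w \<sqsubset> v" if "w \<in> Base (C v)" for w
    proof (rule ccontr)
      assume "\<not> w \<sqsubset> v"
      moreover obtain w' where w': "w \<in> C w'" "C w' \<subset> C v"
        using \<open>w \<in> Base (C v)\<close> by (auto simp: Base_def)
      ultimately have "v \<in> C w'"
        using prec_linear[of w v] C_closed[of w'] unfolding closed_set_def by blast
      then show False
        using C_mem w'(2) by blast
    qed
    then have "closed_span (Base (C v)) \<subseteq> closed_span ?B"
      using 1 by (intro closed_span_subset) blast
    then have "E (f (C v)) \<inter> closed_span (C v) \<subseteq> closed_span ?B"
      using closed_span_superset[of ?B] unfolding F_def by blast
    then have "closed_span (C v) \<subseteq> closed_span ?B"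
      using closed_span_subset split_C by blast
    then show ?case
      using C_self closed_span_superset by blast
  qed
  then have "closed_span ?B = UNIV"
    by blast
  ultimately show ?thesis
    unfolding free_def using orthonormal_Schauder_basisI by blast
qed

end

section \<open>Closed subspaces of free spaces are free\<close>

lemma ultranorm_divide:
  "ultranorm (x / y) = ultranorm x / ultranorm (y :: 'a :: complete_valuation_field)"
  by (simp add: divide_inverse valuation_mult ultranorm_inverse)

lemma countable_dominating_subset:
  fixes \<phi> :: "'b \<Rightarrow> real"
  shows "\<exists>X. countable X \<and> X \<subseteq> M \<and> (\<forall>x\<in>M. \<exists>x'\<in>X. \<phi> x \<le> \<phi> x')"
proof (cases "\<exists>m\<in>M. \<forall>x\<in>M. \<phi> x \<le> \<phi> m")
  case True
  then obtain m where "m \<in> M" "\<forall>x\<in>M. \<phi> x \<le> \<phi> m" by blast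
  then show ?thesis
    by (intro exI[of _ "{m}"]) auto
next
  case False
  define Q where "Q = {q \<in> \<rat>. \<exists>x\<in>M. q \<le> \<phi> x}"
  have "\<forall>q\<in>Q. \<exists>x\<in>M. q \<le> \<phi> x"
    by (simp add: Q_def)
  then obtain p where p: "\<And>q. q \<in> Q \<Longrightarrow> p q \<in> M \<and> q \<le> \<phi> (p q)"
    by metis
  have "\<exists>x'\<in>p ` Q. \<phi> x \<le> \<phi> x'" if "x \<in> M" for x
  proof -
    obtain y where y: "y \<in> M" "\<phi> x < \<phi> y"
      using False \<open>x \<in> M\<close> by (meson linorder_not_le)
    obtain q where q: "q \<in> \<rat>" "\<phi> x < q" "q < \<phi> y"
      using Rats_dense_in_real[OF y(2)] by blast
    then have "q \<in> Q"
      using y(1) by (auto simp: Q_def intro!: bexI[of _ y])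
    then show ?thesis
      using p[of q] q(2) by (intro bexI[of _ "p q"]) auto
  qed
  moreover have "countable Q"
    unfolding Q_def by (rule countable_subset[OF _ countable_rat]) auto
  ultimately show ?thesis
    using p by (intro exI[of _ "p ` Q"]) auto
qed

context ultrametric_banach_space
begin

lemma orthonormal_insert:
  assumes "orthonormal A" "ultranorm b = 1"
    and "\<And>u c. u \<in> span A \<Longrightarrow> ultranorm c \<le> ultranorm (u + c *s b)"
  shows "orthonormal (insert b A)"
  unfolding orthonormal_def
proof (intro conjI allI impI ballI)
  fix e assume "e \<in> insert b A"
  then show "ultranorm e = 1"
    using assms(1,2) orthonormal_unit by blast
next
  fix S c e assume S: "finite S \<and> S \<subseteq> insert b A" and "e \<in> S"
  show "ultranorm (c e) \<le> ultranorm (\<Sum>e\<in>S. c e *s e)"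
  proof (cases "b \<in> S")
    case False
    then show ?thesis
      using S \<open>e \<in> S\<close> by (intro orthonormalD[OF assms(1)]) auto
  next
    case True
    define S' where "S' = S - {b}"
    define u where "u = (\<Sum>e\<in>S'. c e *s e)"
    have S': "finite S'" "S' \<subseteq> A"
      using S by (auto simp: S'_def)
    have sum: "(\<Sum>e\<in>S. c e *s e) = u + c b *s b"
      using S True by (simp add: u_def S'_def sum.remove[of S b] add.commute)
    have "u \<in> span A"
      unfolding u_def using S'(2) by (intro span_sum span_scale span_base) auto
    then have b: "ultranorm (c b) \<le> ultranorm (u + c b *s b)"
      by (rule assms(3))
    then have "ultranorm u \<le> ultranorm (u + c b *s b)"
      using ultranorm_diff_le[of "u + c b *s b" "c b *s b"]
      by (simp add: ultranorm_scale assms(2))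
    moreover have "ultranorm (c e) \<le> ultranorm u" if "e \<noteq> b"
      unfolding u_def using S' that \<open>e \<in> S\<close>
      by (intro orthonormalD[OF assms(1)]) (auto simp: S'_def)
    ultimately show ?thesis
      unfolding sum using b by (cases "e = b") auto
  qed
qed

end

text \<open>
  A Banach space identified with a space of functions vanishing at infinity, with the supremum norm:
  \<open>coord x e\<close> is the value of \<open>x\<close> at \<open>e\<close>.  Surjectivity of the identification plays no role.
\<close>

locale coordinatized_banach_space = ultrametric_banach_space scale
  for scale :: "'k :: complete_valuation_field \<Rightarrow> 'v :: complete_ultranormed_group \<Rightarrow> 'v"
      (infixr \<open>*s\<close> 75) +
  fixes coord :: "'v \<Rightarrow> 'i \<Rightarrow> 'k"
  assumes coord_diff: "coord (x - y) e = coord x e - coord y e"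
    and coord_scale: "coord (a *s x) e = a * coord x e"
    and ultranorm_le_iff: "0 \<le> r \<Longrightarrow> ultranorm x \<le> r \<longleftrightarrow> (\<forall>e. ultranorm (coord x e) \<le> r)"
    and finite_large_coord: "\<epsilon> > 0 \<Longrightarrow> finite {e. \<epsilon> \<le> ultranorm (coord x e)}"
begin

definition supp :: "'v \<Rightarrow> 'i set" where
  "supp x = {e. coord x e \<noteq> 0}"

text \<open>
  The vectors of \<open>W\<close> supported in \<open>J\<close>.
\<close>

definition restr :: "'v set \<Rightarrow> 'i set \<Rightarrow> 'v set" where
  "restr W J = {x \<in> W. supp x \<subseteq> J}"

text \<open>
  No vector supported in \<open>J\<close> is closer to \<open>x\<close> than the supremum of the coordinates of \<open>x\<close>
  outside \<open>J\<close>.  The set \<open>J\<close> is good for \<open>W\<close> if for every \<open>x \<in> W\<close> some vector of \<open>W\<close> supported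
  in \<open>J\<close> is as close as that.
\<close>

definition good :: "'v set \<Rightarrow> 'i set \<Rightarrow> bool" where
  "good W J \<longleftrightarrow> (\<forall>x\<in>W. \<forall>r\<ge>0. (\<forall>e. e \<notin> J \<longrightarrow> ultranorm (coord x e) \<le> r) \<longrightarrow>
     (\<exists>y\<in>restr W J. ultranorm (x - y) \<le> r))"

lemma goodD:
  assumes "good W J" "x \<in> W" "0 \<le> r" "\<And>e. e \<notin> J \<Longrightarrow> ultranorm (coord x e) \<le> r"
  obtains y where "y \<in> restr W J" "ultranorm (x - y) \<le> r"
proof -
  have "\<forall>e. e \<notin> J \<longrightarrow> ultranorm (coord x e) \<le> r"
    using assms(4) by simp
  then have "\<exists>y\<in>restr W J. ultranorm (x - y) \<le> r"
    using assms(1-3) unfolding good_def by simp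
  then show thesis using that by blast
qed

lemma coord_0: "coord 0 e = 0"
  using coord_diff[of 0 0] by simp

lemma coord_add: "coord (x + y) e = coord x e + coord y e"
  using coord_diff[of x "- y" e] coord_diff[of 0 y e] by (simp add: coord_0)

lemma coord_le: "ultranorm (coord x e) \<le> ultranorm x"
  using ultranorm_le_iff[OF ultranorm_nonneg, of x x] by simp

lemma coord_eq_0: "x \<in> restr W J \<Longrightarrow> e \<notin> J \<Longrightarrow> coord x e = 0"
  by (auto simp: restr_def supp_def)

lemma restrI: "x \<in> W \<Longrightarrow> (\<And>e. e \<notin> J \<Longrightarrow> coord x e = 0) \<Longrightarrow> x \<in> restr W J"
  by (auto simp: restr_def supp_def)

lemma restr_subset: "restr W J \<subseteq> W"
  by (auto simp: restr_def)

lemma restr_mono: "J \<subseteq> J' \<Longrightarrow> restr W J \<subseteq> restr W J'"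
  by (auto simp: restr_def)

lemma restr_restr: "J \<subseteq> J' \<Longrightarrow> restr (restr W J') J = restr W J"
  by (auto simp: restr_def)

lemma countable_supp: "countable (supp x)"
proof -
  have "e \<in> (\<Union>n. {e. inverse (real (Suc n)) \<le> ultranorm (coord x e)})" if "e \<in> supp x" for e
  proof -
    have "ultranorm (coord x e) > 0"
      using that ultranorm_nonneg[of "coord x e"] ultranorm_eq_0_iff[of "coord x e"]
      by (simp add: supp_def)
    then obtain n where "inverse (real (Suc n)) < ultranorm (coord x e)"
      using reals_Archimedean by blast
    then show ?thesis
      by (auto intro!: exI[of _ n])
  qed
  moreover have "countable (\<Union>n. {e. inverse (real (Suc n)) \<le> ultranorm (coord x e)})"
    by (rule countable_UN) (simp_all add: countable_finite finite_large_coord)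
  ultimately show ?thesis
    by (intro countable_subset[of "supp x" "\<Union>n. {e. inverse (real (Suc n)) \<le> ultranorm (coord x e)}"] subsetI)
qed

lemma largest_coord:
  assumes "e0 \<notin> J" "coord x e0 \<noteq> 0"
  obtains e1 where "e1 \<notin> J" "coord x e1 \<noteq> 0"
    "\<And>e. e \<notin> J \<Longrightarrow> ultranorm (coord x e) \<le> ultranorm (coord x e1)"
proof -
  have pos: "ultranorm (coord x e0) > 0"
    using assms(2) ultranorm_nonneg[of "coord x e0"] ultranorm_eq_0_iff[of "coord x e0"] by simp
  define D where "D = {e. ultranorm (coord x e0) \<le> ultranorm (coord x e)} - J"
  have D: "finite D" "e0 \<in> D"
    using finite_large_coord[OF pos] assms(1) by (auto simp: D_def)
  have "Max ((\<lambda>e. ultranorm (coord x e)) ` D) \<in> (\<lambda>e. ultranorm (coord x e)) ` D"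
    using D by (intro Max_in) auto
  then obtain e1 where e1: "e1 \<in> D" "Max ((\<lambda>e. ultranorm (coord x e)) ` D) = ultranorm (coord x e1)"
    by auto
  have le: "ultranorm (coord x e) \<le> ultranorm (coord x e1)" if "e \<in> D" for e
    unfolding e1(2)[symmetric] using D(1) that by (intro Max_ge) auto
  show thesis
  proof
    show "e1 \<notin> J"
      using e1(1) by (simp add: D_def)
    show "coord x e1 \<noteq> 0"
      using le[OF D(2)] pos by (auto simp: ultranorm_0)
    show "ultranorm (coord x e) \<le> ultranorm (coord x e1)" if "e \<notin> J" for e
      using le[of e] le[OF D(2)] that by (cases "e \<in> D") (auto simp: D_def)
  qed
qed

lemma subspace_restr:
  assumes "subspace W"
  shows "subspace (restr W J)"
proof (rule subspaceI)
  show "0 \<in> restr W J"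
    using subspace_0[OF assms] by (intro restrI) (auto simp: coord_0)
  show "x + y \<in> restr W J" if "x \<in> restr W J" "y \<in> restr W J" for x y
  proof (rule restrI)
    show "x + y \<in> W"
      using that restr_subset by (intro subspace_add[OF assms]) blast+
    show "coord (x + y) e = 0" if "e \<notin> J" for e
      using coord_eq_0[OF \<open>x \<in> restr W J\<close> that] coord_eq_0[OF \<open>y \<in> restr W J\<close> that]
      by (simp add: coord_add)
  qed
  show "c *s x \<in> restr W J" if "x \<in> restr W J" for c x
  proof (rule restrI)
    show "c *s x \<in> W"
      using that restr_subset by (intro subspace_scale[OF assms]) blast
    show "coord (c *s x) e = 0" if "e \<notin> J" for e
      using coord_eq_0[OF \<open>x \<in> restr W J\<close> that] by (simp add: coord_scale)
  qed
qed

lemma closed_restr: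
  assumes "closed W"
  shows "closed (restr W J)"
proof -
  have "closure (restr W J) \<subseteq> restr W J"
  proof (intro subsetI restrI)
    fix x assume x: "x \<in> closure (restr W J)"
    show "x \<in> W"
      using closure_minimal[OF restr_subset assms] x by blast
    fix e assume "e \<notin> J"
    show "coord x e = 0"
    proof (rule ccontr)
      assume "coord x e \<noteq> 0"
      then have "ultranorm (coord x e) > 0"
        using ultranorm_nonneg[of "coord x e"] ultranorm_eq_0_iff[of "coord x e"] by simp
      then obtain y where "y \<in> restr W J" "ultranorm (x - y) < ultranorm (coord x e)"
        by (rule closure_ultranormD[OF x])
      then show False
        using coord_le[of "x - y" e] coord_eq_0[of y W J e] \<open>e \<notin> J\<close> by (simp add: coord_diff)
    qed
  qed
  then show ?thesis
    using closure_subset closure_eq by blast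
qed

text \<open>
  Consider the vectors of \<open>W\<close> whose coordinates outside \<open>J \<union> C\<close> are at most \<open>r\<close>.  Modulo vectors whose
  coordinates outside \<open>J\<close> are at most \<open>r\<close>, countably many of them span all: enumerate \<open>C\<close> and
  clear the coordinates that exceed \<open>r\<close> one by one, starting with the last one.  A single coordinate is
  cleared by a member of a countable family in which that coordinate is dominating.
\<close>

lemma countable_approximation:
  assumes W: "subspace W" and C: "countable C" and "r > 0"
  shows "\<exists>X. countable X \<and> X \<subseteq> W \<and>
    (\<forall>x\<in>W. (\<forall>e. e \<notin> J \<union> C \<longrightarrow> ultranorm (coord x e) \<le> r) \<longrightarrow>
      (\<exists>y\<in>span X. \<forall>e. e \<notin> J \<longrightarrow> ultranorm (coord (x - y) e) \<le> r))"
proof -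
  \<comment> \<open>Coordinates outside \<open>J\<close> may exceed \<open>r\<close> only at elements of \<open>C\<close> with number below \<open>n\<close>.\<close>
  define N where
    "N n = {x \<in> W. \<forall>e. e \<notin> J \<longrightarrow> (e \<in> C \<longrightarrow> n \<le> to_nat_on C e) \<longrightarrow> ultranorm (coord x e) \<le> r}" for n
  have "\<forall>n. \<exists>X. countable X \<and> X \<subseteq> N (Suc n) \<and> (\<forall>x\<in>N (Suc n). \<exists>x'\<in>X.
      ultranorm (coord x (from_nat_into C n)) \<le> ultranorm (coord x' (from_nat_into C n)))"
    by (intro allI countable_dominating_subset)
  then obtain X where X: "\<And>n. countable (X n)" "\<And>n. X n \<subseteq> N (Suc n)"
    and dom: "\<And>n x. x \<in> N (Suc n) \<Longrightarrow> \<exists>x'\<in>X n.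
      ultranorm (coord x (from_nat_into C n)) \<le> ultranorm (coord x' (from_nat_into C n))"
    by metis
  have approx: "\<exists>y\<in>span (\<Union>n. X n). \<forall>e. e \<notin> J \<longrightarrow> ultranorm (coord (x - y) e) \<le> r"
    if "x \<in> N n" for n x
    using that
  proof (induction n arbitrary: x)
    case 0
    then show ?case
      by (intro bexI[of _ 0]) (auto simp: N_def span_zero)
  next
    case (Suc n)
    define e0 where "e0 = from_nat_into C n"
    obtain x' where x': "x' \<in> X n" "ultranorm (coord x e0) \<le> ultranorm (coord x' e0)"
      using dom[OF Suc.prems] unfolding e0_def by blast
    then have x'N: "x' \<in> N (Suc n)"
      using X(2) by blast
    define a where "a = coord x e0 / coord x' e0"
    have a_le: "ultranorm a \<le> 1"
    proof (cases "coord x' e0 = 0")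
      case False
      then have "ultranorm (coord x' e0) > 0"
        using ultranorm_nonneg[of "coord x' e0"] ultranorm_eq_0_iff[of "coord x' e0"] by simp
      then show ?thesis
        using x'(2) by (simp add: a_def ultranorm_divide)
    qed (simp add: a_def ultranorm_0)
    have a_eq: "a * coord x' e0 = coord x e0"
    proof (cases "coord x' e0 = 0")
      case True
      then have "ultranorm (coord x e0) = 0"
        using x'(2) ultranorm_nonneg[of "coord x e0"] by (simp add: ultranorm_0)
      then show ?thesis
        using True by (simp add: ultranorm_eq_0_iff)
    qed (simp add: a_def)
    have "x - a *s x' \<in> N n"
      unfolding N_def
    proof (intro CollectI conjI allI impI)
      show "x - a *s x' \<in> W"
        using Suc.prems x'N W by (intro subspace_diff subspace_scale) (auto simp: N_def)
      fix e assume e: "e \<notin> J" "e \<in> C \<longrightarrow> n \<le> to_nat_on C e"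
      show "ultranorm (coord (x - a *s x') e) \<le> r"
      proof (cases "e \<in> C \<and> to_nat_on C e = n")
        case True
        then have "e = e0"
          using C by (auto simp: e0_def)
        then show ?thesis
          using a_eq \<open>r > 0\<close> by (simp add: coord_diff coord_scale ultranorm_0)
      next
        case False
        with e have "ultranorm (coord x e) \<le> r" "ultranorm (coord x' e) \<le> r"
          using Suc.prems x'N by (auto simp: N_def)
        moreover have "ultranorm a * ultranorm (coord x' e) \<le> 1 * ultranorm (coord x' e)"
          using a_le ultranorm_nonneg by (rule mult_right_mono)
        ultimately show ?thesis
          using ultranorm_diff_le[of "coord x e" "a * coord x' e"]
          by (simp add: coord_diff coord_scale valuation_mult)
      qed
    qed
    then obtain y where y: "y \<in> span (\<Union>n. X n)"
      "\<forall>e. e \<notin> J \<longrightarrow> ultranorm (coord (x - a *s x' - y) e) \<le> r"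
      using Suc.IH by blast
    have "x' \<in> span (\<Union>n. X n)"
      using x'(1) by (intro span_base) blast
    then have "a *s x' + y \<in> span (\<Union>n. X n)"
      using y(1) by (intro span_add span_scale)
    then show ?case
      using y(2) by (intro bexI[of _ "a *s x' + y"]) (simp_all add: diff_diff_eq)
  qed
  have "\<exists>n. x \<in> N n" if x: "x \<in> W" "\<forall>e. e \<notin> J \<union> C \<longrightarrow> ultranorm (coord x e) \<le> r" for x
  proof -
    have "finite (to_nat_on C ` {e. r \<le> ultranorm (coord x e)})"
      using finite_large_coord[OF \<open>r > 0\<close>] by simp
    then obtain n where n: "\<And>e. r \<le> ultranorm (coord x e) \<Longrightarrow> to_nat_on C e < n"
      unfolding finite_nat_set_iff_bounded by blast
    have "ultranorm (coord x e) \<le> r" if "e \<notin> J" "e \<in> C \<longrightarrow> n \<le> to_nat_on C e" for e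
      using n[of e] x(2) that by (cases "e \<in> C") force+
    then show ?thesis
      using x(1) by (auto simp: N_def)
  qed
  then have "\<exists>y\<in>span (\<Union>n. X n). \<forall>e. e \<notin> J \<longrightarrow> ultranorm (coord (x - y) e) \<le> r"
    if "x \<in> W" "\<forall>e. e \<notin> J \<union> C \<longrightarrow> ultranorm (coord x e) \<le> r" for x
    using approx that by metis
  moreover have "countable (\<Union>n. X n)"
    using X(1) by blast
  moreover have "(\<Union>n. X n) \<subseteq> W"
    using X(2) by (force simp: N_def)
  ultimately show ?thesis
    by (intro exI[of _ "\<Union>n. X n"]) blast
qed

text \<open>
  Close off \<open>D0\<close> under the supports of the countable families from the previous lemma.
  The radii \<open>1 / (n + 1)\<close> yield density.  Goodness needs only the radius \<open>1\<close>, because a nonzero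
  supremum of coordinates is attained and can be scaled to \<open>1\<close>.
\<close>

lemma good_extension:
  assumes W: "subspace W" and J: "good W J" and "countable D0"
  obtains C X where "D0 \<subseteq> C" "good W (J \<union> C)" "countable X" "X \<subseteq> restr W (J \<union> C)"
    "restr W (J \<union> C) \<subseteq> closed_span (restr W J \<union> X)"
proof -
  have approx: "\<exists>X. countable X \<and> X \<subseteq> W \<and>
      (\<forall>n. \<forall>x\<in>W. (\<forall>e. e \<notin> J \<union> C \<longrightarrow> ultranorm (coord x e) \<le> inverse (real (Suc n))) \<longrightarrow>
        (\<exists>y\<in>span (restr W J \<union> X). ultranorm (x - y) \<le> inverse (real (Suc n))))"
    if C: "countable C" for C
  proof -
    have "\<forall>n. \<exists>X. countable X \<and> X \<subseteq> W \<and>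
        (\<forall>x\<in>W. (\<forall>e. e \<notin> J \<union> C \<longrightarrow> ultranorm (coord x e) \<le> inverse (real (Suc n))) \<longrightarrow>
          (\<exists>y\<in>span X. \<forall>e. e \<notin> J \<longrightarrow> ultranorm (coord (x - y) e) \<le> inverse (real (Suc n))))"
      using countable_approximation[OF W C] by simp
    then obtain X where X: "\<And>n. countable (X n)" "\<And>n. X n \<subseteq> W"
      and y: "\<And>n x. x \<in> W \<Longrightarrow> \<forall>e. e \<notin> J \<union> C \<longrightarrow> ultranorm (coord x e) \<le> inverse (real (Suc n)) \<Longrightarrow>
          \<exists>y\<in>span (X n). \<forall>e. e \<notin> J \<longrightarrow> ultranorm (coord (x - y) e) \<le> inverse (real (Suc n))"
      by metis
    have "\<exists>y\<in>span (restr W J \<union> (\<Union>n. X n)). ultranorm (x - y) \<le> inverse (real (Suc n))"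
      if x: "x \<in> W" "\<forall>e. e \<notin> J \<union> C \<longrightarrow> ultranorm (coord x e) \<le> inverse (real (Suc n))" for n x
    proof -
      obtain y where y: "y \<in> span (X n)"
        "\<forall>e. e \<notin> J \<longrightarrow> ultranorm (coord (x - y) e) \<le> inverse (real (Suc n))"
        using y[OF x] by blast
      have "x - y \<in> W"
        using x(1) y(1) span_minimal[OF X(2) W] subspace_diff[OF W] by blast
      then obtain w where w: "w \<in> restr W J" "ultranorm (x - y - w) \<le> inverse (real (Suc n))"
        by (rule goodD[OF J, of "x - y" "inverse (real (Suc n))"]) (use y(2) in auto)
      have "span (X n) \<subseteq> span (restr W J \<union> (\<Union>n. X n))"
        by (intro span_mono) blast
      then have "y + w \<in> span (restr W J \<union> (\<Union>n. X n))"
        using y(1) w(1) by (intro span_add) (auto intro: span_base)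
      then show ?thesis
        using w(2) by (intro bexI[of _ "y + w"]) (simp_all add: diff_diff_eq)
    qed
    moreover have "countable (\<Union>n. X n)" "(\<Union>n. X n) \<subseteq> W"
      using X by blast+
    ultimately show ?thesis
      by (intro exI[of _ "\<Union>n. X n"]) simp
  qed
  then have "\<forall>C. \<exists>X. countable C \<longrightarrow> countable X \<and> X \<subseteq> W \<and>
      (\<forall>n. \<forall>x\<in>W. (\<forall>e. e \<notin> J \<union> C \<longrightarrow> ultranorm (coord x e) \<le> inverse (real (Suc n))) \<longrightarrow>
        (\<exists>y\<in>span (restr W J \<union> X). ultranorm (x - y) \<le> inverse (real (Suc n))))"
    by simp
  then obtain \<Phi> where "\<forall>C. countable C \<longrightarrow> countable (\<Phi> C) \<and> \<Phi> C \<subseteq> W \<and>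
      (\<forall>n. \<forall>x\<in>W. (\<forall>e. e \<notin> J \<union> C \<longrightarrow> ultranorm (coord x e) \<le> inverse (real (Suc n))) \<longrightarrow>
        (\<exists>y\<in>span (restr W J \<union> \<Phi> C). ultranorm (x - y) \<le> inverse (real (Suc n))))"
    by (rule choice[THEN exE])
  then have \<Phi>: "countable (\<Phi> C)" "\<Phi> C \<subseteq> W"
      "\<And>n x. x \<in> W \<Longrightarrow> \<forall>e. e \<notin> J \<union> C \<longrightarrow> ultranorm (coord x e) \<le> inverse (real (Suc n)) \<Longrightarrow>
        \<exists>y\<in>span (restr W J \<union> \<Phi> C). ultranorm (x - y) \<le> inverse (real (Suc n))"
    if "countable C" for C
    using that by simp_all
  define next_set where "next_set C = C \<union> (\<Union>x\<in>\<Phi> C. supp x)" for C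
  define K where "K i = (next_set ^^ i) D0" for i
  define C where "C = (\<Union>i. K i)"
  define X where "X = (\<Union>i. \<Phi> (K i))"
  have K_Suc: "K (Suc i) = K i \<union> (\<Union>x\<in>\<Phi> (K i). supp x)" for i
    by (simp add: K_def next_set_def)
  have K: "countable (K i)" for i
  proof (induction i)
    case 0
    show ?case using \<open>countable D0\<close> by (simp add: K_def)
  next
    case (Suc i)
    then show ?case
      unfolding K_Suc using \<Phi>(1) countable_supp by blast
  qed
  have K_mono: "K i \<subseteq> K j" if "i \<le> j" for i j
    using lift_Suc_mono_le[of K, OF _ that] K_Suc by blast
  have X: "countable X" "X \<subseteq> restr W (J \<union> C)"
  proof -
    show "countable X"
      unfolding X_def using \<Phi>(1)[OF K] by blast
    show "X \<subseteq> restr W (J \<union> C)"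
    proof
      fix x assume "x \<in> X"
      then obtain i where i: "x \<in> \<Phi> (K i)"
        by (auto simp: X_def)
      then have "supp x \<subseteq> K (Suc i)"
        unfolding K_Suc by blast
      then show "x \<in> restr W (J \<union> C)"
        using i \<Phi>(2)[OF K] unfolding restr_def C_def by blast
    qed
  qed
  have near: "\<exists>y\<in>span (restr W J \<union> X). ultranorm (x - y) \<le> inverse (real (Suc n))"
    if x: "x \<in> W" "\<And>e. e \<notin> J \<union> C \<Longrightarrow> ultranorm (coord x e) \<le> inverse (real (Suc n))" for n x
  proof -
    define D where "D = {e. inverse (real (Suc n)) \<le> ultranorm (coord x e)} \<inter> C"
    have "finite D" "D \<subseteq> \<Union>(range K)"
      using finite_large_coord[of "inverse (real (Suc n))"] by (auto simp: D_def C_def)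
    moreover have "range K \<noteq> {}"
      by simp
    moreover have "subset.chain UNIV (range K)"
      unfolding subset_chain_def
    proof (intro conjI ballI)
      fix A B assume "A \<in> range K" "B \<in> range K"
      then obtain i j where "A = K i" "B = K j" by blast
      then show "A \<subseteq> B \<or> B \<subseteq> A"
        using K_mono[of i j] K_mono[of j i] nat_le_linear[of i j] by auto
    qed simp
    ultimately obtain A where "A \<in> range K" "D \<subseteq> A"
      by (rule finite_subset_Union_chain)
    then obtain i where i: "D \<subseteq> K i"
      by auto
    have "ultranorm (coord x e) \<le> inverse (real (Suc n))" if "e \<notin> J \<union> K i" for e
    proof (rule ccontr)
      assume "\<not> ?thesis"
      then have "e \<in> C" "e \<in> {e. inverse (real (Suc n)) \<le> ultranorm (coord x e)}"
        using x(2)[of e] that by auto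
      then show False
        using i that unfolding D_def by blast
    qed
    then obtain y where "y \<in> span (restr W J \<union> \<Phi> (K i))" "ultranorm (x - y) \<le> inverse (real (Suc n))"
      using \<Phi>(3)[OF K x(1)] by blast
    moreover have "span (restr W J \<union> \<Phi> (K i)) \<subseteq> span (restr W J \<union> X)"
      by (intro span_mono) (auto simp: X_def)
    ultimately show ?thesis by blast
  qed
  have span_sub: "span (restr W J \<union> X) \<subseteq> restr W (J \<union> C)"
    using X(2) restr_mono[of J "J \<union> C" W] by (intro span_minimal subspace_restr W) auto
  show thesis
  proof
    show "D0 \<subseteq> C"
      unfolding C_def by (rule order_trans[OF _ UN_upper[of 0]]) (simp_all add: K_def)
    show "countable X" "X \<subseteq> restr W (J \<union> C)"
      by (fact X)+
    show "restr W (J \<union> C) \<subseteq> closed_span (restr W J \<union> X)"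
    proof
      fix x assume x: "x \<in> restr W (J \<union> C)"
      show "x \<in> closed_span (restr W J \<union> X)"
        unfolding in_closed_span
      proof (intro allI impI)
        fix \<epsilon> :: real assume "\<epsilon> > 0"
        then obtain n where n: "inverse (real (Suc n)) < \<epsilon>"
          using reals_Archimedean by blast
        have "\<exists>y\<in>span (restr W J \<union> X). ultranorm (x - y) \<le> inverse (real (Suc n))"
        proof (rule near)
          show "x \<in> W"
            using x restr_subset by blast
          show "ultranorm (coord x e) \<le> inverse (real (Suc n))" if "e \<notin> J \<union> C" for e
            using coord_eq_0[OF x that] by (simp add: ultranorm_0)
        qed
        then show "\<exists>y\<in>span (restr W J \<union> X). ultranorm (x - y) < \<epsilon>"
          using n by (meson le_less_trans)
      qed
    qed
    show "good W (J \<union> C)"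
      unfolding good_def
    proof (intro ballI allI impI)
      fix x and r :: real
      assume x: "x \<in> W" and r: "0 \<le> r" "\<forall>e. e \<notin> J \<union> C \<longrightarrow> ultranorm (coord x e) \<le> r"
      show "\<exists>y\<in>restr W (J \<union> C). ultranorm (x - y) \<le> r"
      proof (cases "\<forall>e. e \<notin> J \<union> C \<longrightarrow> coord x e = 0")
        case True
        then have "x \<in> restr W (J \<union> C)"
          using x by (intro restrI) auto
        then show ?thesis
          using r(1) by (intro bexI[of _ x]) (auto simp: ultranorm_0)
      next
        case False
        then obtain e0 where "e0 \<notin> J \<union> C" "coord x e0 \<noteq> 0" by blast
        then obtain e1 where e1: "e1 \<notin> J \<union> C" "coord x e1 \<noteq> 0"
          "\<And>e. e \<notin> J \<union> C \<Longrightarrow> ultranorm (coord x e) \<le> ultranorm (coord x e1)"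
          by (rule largest_coord) blast
        define c where "c = coord x e1"
        have c: "c \<noteq> 0" "ultranorm c > 0" "ultranorm c \<le> r"
          using e1(1,2) r(2) ultranorm_nonneg[of c] ultranorm_eq_0_iff[of c] by (auto simp: c_def)
        have "\<exists>y\<in>span (restr W J \<union> X). ultranorm (inverse c *s x - y) \<le> inverse (real (Suc 0))"
        proof (rule near)
          show "inverse c *s x \<in> W"
            using x by (rule subspace_scale[OF W])
          show "ultranorm (coord (inverse c *s x) e) \<le> inverse (real (Suc 0))" if "e \<notin> J \<union> C" for e
          proof -
            have "coord (inverse c *s x) e = coord x e / c"
              by (simp add: coord_scale divide_inverse mult.commute)
            then show ?thesis
              using e1(3)[OF that] c(2) by (simp add: ultranorm_divide c_def)
          qed
        qed
        then obtain y where y: "y \<in> restr W (J \<union> C)" "ultranorm (inverse c *s x - y) \<le> 1"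
          using span_sub by auto
        have "x - c *s y = c *s (inverse c *s x - y)"
          using c(1) by (simp add: scale_right_diff_distrib)
        then have "ultranorm (x - c *s y) \<le> ultranorm c"
          using y(2) c(2) by (simp only: ultranorm_scale) (simp add: mult_left_le)
        then show ?thesis
          using c(3) y(1) subspace_scale[OF subspace_restr[OF W]] by (intro bexI[of _ "c *s y"]) auto
      qed
    qed
  qed
qed

text \<open>
  The set \<open>P\<close> of coordinates outside \<open>J\<close> records the pivots of a stage \<open>D\<close> of the
  Gram-Schmidt process: modulo vectors of \<open>W\<close> supported in \<open>J\<close>, the norm on the span of \<open>D\<close> is read off from the coordinates in \<open>P\<close>, and every
  vector of \<open>W\<close> can be reduced by the span to one vanishing on \<open>P\<close>.
\<close>

definition pivots :: "'v set \<Rightarrow> 'i set \<Rightarrow> 'v set \<Rightarrow> 'i set \<Rightarrow> bool" where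
  "pivots W J D P \<longleftrightarrow> P \<inter> J = {} \<and>
    (\<forall>u\<in>span (restr W J \<union> D). \<forall>\<rho>\<ge>0. (\<forall>p\<in>P. ultranorm (coord u p) \<le> \<rho>) \<longrightarrow>
      (\<exists>w\<in>restr W J. ultranorm (u - w) \<le> \<rho>)) \<and>
    (\<forall>y\<in>W. \<exists>u\<in>span (restr W J \<union> D). \<forall>p\<in>P. coord (y - u) p = 0)"

text \<open>
  Reduce \<open>x\<close> to a vector vanishing on \<open>P\<close>, use goodness of \<open>J\<close> to make its norm equal to its largest
  coordinate outside \<open>J\<close>, and normalize.  That coordinate is the new pivot.
\<close>

lemma gram_schmidt_step:
  assumes W: "subspace W" and J: "good W J" and x: "x \<in> W" and D: "D \<subseteq> W"
    and P: "pivots W J D P" and x_notin: "x \<notin> span (restr W J \<union> D)"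
  obtains b e1 where "b \<in> W" "ultranorm b = 1" "x \<in> span (restr W J \<union> insert b D)"
    and "\<forall>u\<in>span (restr W J \<union> D). \<forall>c. ultranorm c \<le> ultranorm (u + c *s b)"
    and "pivots W J (insert b D) (insert e1 P)"
proof -
  let ?U = "span (restr W J \<union> D)"
  have U_W: "?U \<subseteq> W"
    using D restr_subset by (intro span_minimal W) blast
  obtain u0 where u0: "u0 \<in> ?U" "\<And>p. p \<in> P \<Longrightarrow> coord (x - u0) p = 0"
    using P x unfolding pivots_def by blast
  define x' where "x' = x - u0"
  have x': "x' \<in> W"
    unfolding x'_def using x u0(1) U_W by (intro subspace_diff[OF W]) blast+
  have "\<exists>e0. e0 \<notin> J \<and> coord x' e0 \<noteq> 0"
  proof (rule ccontr)
    assume "\<nexists>e0. e0 \<notin> J \<and> coord x' e0 \<noteq> 0"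
    then have "x' \<in> restr W J"
      using x' by (intro restrI) auto
    then have "x' + u0 \<in> ?U"
      using u0(1) by (intro span_add) (auto intro: span_base)
    then show False
      using x_notin by (simp add: x'_def)
  qed
  then obtain e0 where "e0 \<notin> J" "coord x' e0 \<noteq> 0" by blast
  then obtain e1 where e1: "e1 \<notin> J" "coord x' e1 \<noteq> 0"
    "\<And>e. e \<notin> J \<Longrightarrow> ultranorm (coord x' e) \<le> ultranorm (coord x' e1)"
    by (rule largest_coord) blast
  define a where "a = coord x' e1"
  have a: "ultranorm a > 0" "a \<noteq> 0"
    using e1(2) ultranorm_nonneg[of a] ultranorm_eq_0_iff[of a] by (auto simp: a_def)
  obtain w where w: "w \<in> restr W J" "ultranorm (x' - w) \<le> ultranorm a"
    by (rule goodD[OF J x', of "ultranorm a"]) (use e1(3) ultranorm_nonneg in \<open>auto simp: a_def\<close>)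
  define b where "b = inverse a *s (x' - w)"
  have b_W: "b \<in> W"
    unfolding b_def using x' w(1) restr_subset
    by (intro subspace_scale[OF W] subspace_diff[OF W]) blast+
  have b_e1: "coord b e1 = 1"
    using a(2) coord_eq_0[OF w(1) e1(1)] by (simp add: b_def coord_scale coord_diff a_def)
  have b_P: "coord b p = 0" if "p \<in> P" for p
  proof -
    have "coord x' p = 0"
      using u0(2)[OF that] by (simp add: x'_def)
    moreover have "coord w p = 0"
      using coord_eq_0[OF w(1)] P that unfolding pivots_def by blast
    ultimately show ?thesis
      by (simp add: b_def coord_scale coord_diff)
  qed
  have "ultranorm b \<le> 1"
    using w(2) a(1) unfolding b_def ultranorm_scale ultranorm_inverse by (simp add: field_simps)
  then have b_norm: "ultranorm b = 1"
    using coord_le[of b e1] by (simp add: b_e1 ultranorm_one)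
  have key: "ultranorm c \<le> \<rho> \<and> (\<exists>w\<in>restr W J. ultranorm (u + c *s b - w) \<le> \<rho>)"
    if u: "u \<in> ?U" and \<rho>: "0 \<le> \<rho>" "\<And>p. p \<in> insert e1 P \<Longrightarrow> ultranorm (coord (u + c *s b) p) \<le> \<rho>" for u c \<rho>
  proof -
    have "ultranorm (coord u p) \<le> \<rho>" if "p \<in> P" for p
      using \<rho>(2)[of p] that b_P[OF that] by (simp add: coord_add coord_scale)
    then have "\<exists>w\<in>restr W J. ultranorm (u - w) \<le> \<rho>"
      using P u \<rho>(1) unfolding pivots_def by simp
    then obtain w where w: "w \<in> restr W J" "ultranorm (u - w) \<le> \<rho>"
      by blast
    have "ultranorm (coord u e1) \<le> \<rho>"
      using coord_le[of "u - w" e1] coord_eq_0[OF w(1) e1(1)] w(2) by (simp add: coord_diff)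
    moreover have "ultranorm (coord u e1 + c) \<le> \<rho>"
      using \<rho>(2)[of e1] by (simp add: coord_add coord_scale b_e1)
    ultimately have c: "ultranorm c \<le> \<rho>"
      using ultranorm_diff_le[of "coord u e1 + c" "coord u e1"] by simp
    have "ultranorm (u - w + c *s b) \<le> \<rho>"
      using ultranorm_add_le[of "u - w" "c *s b"] w(2) c by (simp add: ultranorm_scale b_norm)
    then have "ultranorm (u + c *s b - w) \<le> \<rho>"
      by (simp add: algebra_simps)
    then show ?thesis
      using c w(1) by blast
  qed
  have insert_eq: "restr W J \<union> insert b D = insert b (restr W J \<union> D)"
    by blast
  show thesis
  proof
    show "b \<in> W" "ultranorm b = 1"
      by (fact b_W b_norm)+
    have "a *s b = x' - w"
      using a(2) by (simp add: b_def)
    then have "x = u0 + w + a *s b"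
      by (simp add: x'_def)
    moreover have "u0 + w \<in> span (restr W J \<union> insert b D)"
      using u0(1) w(1) span_mono[of "restr W J \<union> D" "restr W J \<union> insert b D"]
      by (intro span_add) (auto intro: span_base)
    ultimately show "x \<in> span (restr W J \<union> insert b D)"
      by (auto intro!: span_add span_scale intro: span_base)
    show "\<forall>u\<in>?U. \<forall>c. ultranorm c \<le> ultranorm (u + c *s b)"
      using key[OF _ ultranorm_nonneg coord_le] by blast
    show "pivots W J (insert b D) (insert e1 P)"
      unfolding pivots_def
    proof (intro conjI ballI allI impI)
      show "insert e1 P \<inter> J = {}"
        using P e1(1) by (simp add: pivots_def)
    next
      fix u and \<rho> :: real
      assume u: "u \<in> span (restr W J \<union> insert b D)" and \<rho>: "0 \<le> \<rho>"
        "\<forall>p\<in>insert e1 P. ultranorm (coord u p) \<le> \<rho>"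
      obtain c where "u - c *s b \<in> ?U"
        using u unfolding insert_eq span_insert by blast
      then show "\<exists>w\<in>restr W J. ultranorm (u - w) \<le> \<rho>"
        using key[of "u - c *s b" \<rho> c] \<rho> by simp
    next
      fix y assume y: "y \<in> W"
      then obtain u where u: "u \<in> ?U" "\<And>p. p \<in> P \<Longrightarrow> coord (y - u) p = 0"
        using P unfolding pivots_def by blast
      define u' where "u' = u + coord (y - u) e1 *s b"
      have "coord (y - u') p = 0" if "p \<in> insert e1 P" for p
      proof -
        have "coord (y - u') p = coord (y - u) p - coord (y - u) e1 * coord b p"
          by (simp add: u'_def coord_diff coord_add coord_scale)
        then show ?thesis
          using that u(2)[of p] b_P[of p] b_e1 by (cases "p = e1") auto
      qed
      moreover have "u' - coord (y - u) e1 *s b \<in> ?U"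
        using u(1) by (simp add: u'_def)
      then have "u' \<in> span (restr W J \<union> insert b D)"
        unfolding insert_eq span_insert by blast
      ultimately show "\<exists>u\<in>span (restr W J \<union> insert b D). \<forall>p\<in>insert e1 P. coord (y - u) p = 0"
        by blast
    qed
  qed
qed

lemma gram_schmidt:
  assumes W: "subspace W" and J: "good W J"
    and B: "orthonormal B" "B \<subseteq> restr W J" and X: "countable X" "X \<subseteq> W"
  obtains B' where "B \<subseteq> B'" "B' \<subseteq> W" "orthonormal B'" "X \<subseteq> span (restr W J \<union> B')"
proof -
  define adm where "adm D \<longleftrightarrow> D \<subseteq> W \<and> orthonormal (B \<union> D) \<and> (\<exists>P. pivots W J D P)" for D
  have span_restr: "span (restr W J) = restr W J"
    using subspace_restr[OF W] by (simp add: span_eq_iff)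
  have "adm {}"
    unfolding adm_def pivots_def
  proof (intro conjI exI[of _ "{}"] ballI allI impI)
    fix u :: 'v and \<rho> :: real
    assume "u \<in> span (restr W J \<union> {})" "0 \<le> \<rho>"
    then show "\<exists>w\<in>restr W J. ultranorm (u - w) \<le> \<rho>"
      by (intro bexI[of _ u]) (simp_all add: span_restr ultranorm_0)
  next
    show "\<exists>u\<in>span (restr W J \<union> {}). \<forall>p\<in>{}. coord (y - u) p = 0" for y
      using span_zero by blast
  qed (simp_all add: B(1))
  have step: "\<exists>D'. adm D' \<and> D \<subseteq> D' \<and> x \<in> span (restr W J \<union> D')" if D: "adm D" and x: "x \<in> W" for D x
  proof (cases "x \<in> span (restr W J \<union> D)")
    case True
    then show ?thesis using D by blast
  next
    case False
    obtain P where DW: "D \<subseteq> W" and D_orth: "orthonormal (B \<union> D)" and P: "pivots W J D P"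
      using D unfolding adm_def by blast
    obtain b e1 where b: "b \<in> W" "ultranorm b = 1" "x \<in> span (restr W J \<union> insert b D)"
      and orth: "\<forall>u\<in>span (restr W J \<union> D). \<forall>c. ultranorm c \<le> ultranorm (u + c *s b)"
      and P': "pivots W J (insert b D) (insert e1 P)"
      by (rule gram_schmidt_step[OF W J x DW P False])
    have "span (B \<union> D) \<subseteq> span (restr W J \<union> D)"
      using B(2) by (intro span_mono) blast
    then have "orthonormal (insert b (B \<union> D))"
      using orth by (intro orthonormal_insert D_orth b(2)) blast
    then have "adm (insert b D)"
      unfolding adm_def using DW b(1) P' by auto
    then show ?thesis
      using b(3) by blast
  qed
  define x where "x = from_nat_into (insert 0 X)"
  have range_x: "range x = insert 0 X"
    unfolding x_def using X(1) by (intro range_from_nat_into) auto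
  have xW: "x n \<in> W" for n
  proof -
    have "x n \<in> insert 0 X"
      unfolding range_x[symmetric] by (rule rangeI)
    then show ?thesis
      using X(2) subspace_0[OF W] by auto
  qed
  have "\<exists>f. \<forall>n. adm (f n) \<and> (f n \<subseteq> f (Suc n) \<and> x n \<in> span (restr W J \<union> f (Suc n)))"
  proof (rule dependent_nat_choice)
    show "\<exists>D. adm D"
      using \<open>adm {}\<close> by (rule exI)
    show "\<exists>D'. adm D' \<and> (D \<subseteq> D' \<and> x n \<in> span (restr W J \<union> D'))" if "adm D" for D n
      using step[OF that xW] .
  qed
  then obtain f where f: "\<And>n. adm (f n)" "\<And>n. f n \<subseteq> f (Suc n)" "\<And>n. x n \<in> span (restr W J \<union> f (Suc n))"
    by blast
  have f_mono: "f i \<subseteq> f j" if "i \<le> j" for i j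
    using lift_Suc_mono_le[of f, OF f(2) that] .
  show thesis
  proof
    show "B \<subseteq> \<Union>(range (\<lambda>n. B \<union> f n))" by blast
    show "\<Union>(range (\<lambda>n. B \<union> f n)) \<subseteq> W"
      using f(1) B(2) restr_subset unfolding adm_def by blast
    show "orthonormal (\<Union>(range (\<lambda>n. B \<union> f n)))"
    proof (rule orthonormal_Union_chain)
      show "subset.chain {E. orthonormal E} (range (\<lambda>n. B \<union> f n))"
        unfolding subset_chain_def
      proof (intro conjI ballI)
        show "range (\<lambda>n. B \<union> f n) \<subseteq> {E. orthonormal E}"
          using f(1) by (auto simp: adm_def)
        fix A A' assume "A \<in> range (\<lambda>n. B \<union> f n)" "A' \<in> range (\<lambda>n. B \<union> f n)"
        then obtain i j where "A = B \<union> f i" "A' = B \<union> f j" by blast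
        then show "A \<subseteq> A' \<or> A' \<subseteq> A"
          using f_mono[of i j] f_mono[of j i] nat_le_linear[of i j] by blast
      qed
    qed
    show "X \<subseteq> span (restr W J \<union> \<Union>(range (\<lambda>n. B \<union> f n)))"
    proof
      fix y assume "y \<in> X"
      then obtain n where "y = x n"
        using range_x by blast
      moreover have "span (restr W J \<union> f (Suc n)) \<subseteq> span (restr W J \<union> \<Union>(range (\<lambda>n. B \<union> f n)))"
        by (intro span_mono) blast
      ultimately show "y \<in> span (restr W J \<union> \<Union>(range (\<lambda>n. B \<union> f n)))"
        using f(3) by blast
    qed
  qed
qed

text \<open>
  A good set may be replaced by the union of the supports of the vectors of a basis, so that it is
  determined by the basis.
\<close>

lemma good_support:
  assumes "good W J" "subspace W" "closed W" and B: "closed_span B = restr W J"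
  shows "closed_span B = restr W (\<Union>b\<in>B. supp b)" and "good W (\<Union>b\<in>B. supp b)"
proof -
  let ?S = "\<Union>b\<in>B. supp b"
  have BW: "B \<subseteq> restr W J"
    using B closed_span_superset by blast
  then have S: "?S \<subseteq> J"
    by (auto simp: restr_def)
  have "closed_span B \<subseteq> restr W ?S"
    using BW assms(2,3)
    by (intro closed_span_minimal subspace_restr closed_restr) (auto simp: restr_def)
  then show eq: "closed_span B = restr W ?S"
    using B restr_mono[OF S, of W] by blast
  show "good W ?S"
    unfolding good_def
  proof (intro ballI allI impI)
    fix x and r :: real
    assume x: "x \<in> W" "0 \<le> r" "\<forall>e. e \<notin> ?S \<longrightarrow> ultranorm (coord x e) \<le> r"
    obtain y where "y \<in> restr W J" "ultranorm (x - y) \<le> r"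
      by (rule goodD[OF assms(1) x(1,2)]) (use S x(3) in blast)
    then show "\<exists>y\<in>restr W ?S. ultranorm (x - y) \<le> r"
      using eq B by blast
  qed
qed

text \<open>
  Zorn's lemma is applied to the orthonormal sets \<open>B\<close> whose union of supports \<open>S B\<close> is good and
  which are bases of the part of \<open>W\<close> supported in \<open>S B\<close>.
\<close>

lemma closed_subspace_has_orthonormal_basis:
  assumes W: "subspace W" "closed W"
  obtains B where "orthonormal B" "closed_span B = W"
proof -
  define S where "S B = (\<Union>b\<in>B. supp b)" for B :: "'v set"
  define \<Q> where "\<Q> = {B. orthonormal B \<and> closed_span B = restr W (S B) \<and> good W (S B)}"
  have S_mono: "A \<subseteq> B \<Longrightarrow> S A \<subseteq> S B" for A B
    by (auto simp: S_def)
  have zero: "restr W {} = {0}"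
  proof -
    have "x = 0" if "x \<in> restr W {}" for x
    proof -
      have "ultranorm x \<le> 0"
        using coord_eq_0[OF that] by (simp add: ultranorm_le_iff ultranorm_0)
      then show ?thesis
        using ultranorm_nonneg[of x] ultranorm_eq_0_iff[of x] by simp
    qed
    then show ?thesis
      using subspace_0[OF subspace_restr[OF W(1)], of "{}"] by blast
  qed
  have "{} \<in> \<Q>"
  proof -
    have "good W {}"
      unfolding good_def
    proof (intro ballI allI impI)
      fix x and r :: real assume "0 \<le> r" "\<forall>e. e \<notin> {} \<longrightarrow> ultranorm (coord x e) \<le> r"
      then have "ultranorm x \<le> r"
        by (simp add: ultranorm_le_iff)
      then show "\<exists>y\<in>restr W {}. ultranorm (x - y) \<le> r"
        by (simp add: zero)
    qed
    then show ?thesis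
      by (simp add: \<Q>_def S_def orthonormal_empty closed_span_def zero)
  qed
  have "\<Union>\<C> \<in> \<Q>" if ne: "\<C> \<noteq> {}" and chain: "subset.chain \<Q> \<C>" for \<C>
  proof -
    have \<C>: "\<C> \<subseteq> \<Q>" "\<And>A B. A \<in> \<C> \<Longrightarrow> B \<in> \<C> \<Longrightarrow> A \<subseteq> B \<or> B \<subseteq> A"
      using chain by (auto simp: subset_chain_def)
    have orth: "orthonormal (\<Union>\<C>)"
      using \<C> by (intro orthonormal_Union_chain) (auto simp: subset_chain_def \<Q>_def)
    \<comment> \<open>Only finitely many coordinates of \<open>x\<close> are large, so one member of the chain covers them.\<close>
    have near: "\<exists>B\<in>\<C>. \<exists>y\<in>restr W (S B). ultranorm (x - y) \<le> r"
      if x: "x \<in> W" and r: "0 < r" "\<And>e. e \<notin> S (\<Union>\<C>) \<Longrightarrow> ultranorm (coord x e) \<le> r" for x r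
    proof -
      define D where "D = {e. r \<le> ultranorm (coord x e)} \<inter> S (\<Union>\<C>)"
      have "finite D" "D \<subseteq> \<Union>(S ` \<C>)" "S ` \<C> \<noteq> {}"
        using finite_large_coord[OF r(1)] ne by (auto simp: D_def S_def)
      moreover have "subset.chain UNIV (S ` \<C>)"
        unfolding subset_chain_def
      proof (intro conjI ballI)
        fix X Y assume "X \<in> S ` \<C>" "Y \<in> S ` \<C>"
        then obtain A B where AB: "A \<in> \<C>" "X = S A" "B \<in> \<C>" "Y = S B" by blast
        then have "A \<subseteq> B \<or> B \<subseteq> A"
          by (intro \<C>(2))
        then show "X \<subseteq> Y \<or> Y \<subseteq> X"
          unfolding AB(2,4) using S_mono by blast
      qed simp
      ultimately obtain A where "A \<in> S ` \<C>" "D \<subseteq> A"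
        by (rule finite_subset_Union_chain)
      then obtain B where B: "B \<in> \<C>" "D \<subseteq> S B" by blast
      have "ultranorm (coord x e) \<le> r" if "e \<notin> S B" for e
      proof (rule ccontr)
        assume "\<not> ?thesis"
        then have "e \<in> S (\<Union>\<C>)" "e \<in> {e. r \<le> ultranorm (coord x e)}"
          using r(2)[of e] by auto
        then show False
          using B(2) that unfolding D_def by blast
      qed
      moreover have "good W (S B)"
        using B(1) \<C>(1) by (auto simp: \<Q>_def)
      ultimately have "\<exists>y\<in>restr W (S B). ultranorm (x - y) \<le> r"
        using x r(1) unfolding good_def by simp
      then show ?thesis
        using B(1) by blast
    qed
    have "closed_span (\<Union>\<C>) = restr W (S (\<Union>\<C>))"
    proof
      have "B \<subseteq> restr W (S B)" if "B \<in> \<C>" for B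
        using \<C>(1) that closed_span_superset[of B] by (auto simp: \<Q>_def)
      moreover have "restr W (S B) \<subseteq> restr W (S (\<Union>\<C>))" if "B \<in> \<C>" for B
        using that by (intro restr_mono S_mono) blast
      ultimately show "closed_span (\<Union>\<C>) \<subseteq> restr W (S (\<Union>\<C>))"
        by (intro closed_span_minimal subspace_restr closed_restr W) blast
      show "restr W (S (\<Union>\<C>)) \<subseteq> closed_span (\<Union>\<C>)"
      proof
        fix x assume x: "x \<in> restr W (S (\<Union>\<C>))"
        have "x \<in> closure (closed_span (\<Union>\<C>))"
          unfolding in_closure_ultranorm
        proof (intro allI impI)
          fix \<epsilon> :: real assume "\<epsilon> > 0"
          have "\<exists>B\<in>\<C>. \<exists>y\<in>restr W (S B). ultranorm (x - y) \<le> \<epsilon> / 2"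
          proof (rule near)
            show "x \<in> W"
              using x restr_subset by blast
            show "ultranorm (coord x e) \<le> \<epsilon> / 2" if "e \<notin> S (\<Union>\<C>)" for e
              using coord_eq_0[OF x that] \<open>\<epsilon> > 0\<close> by (simp add: ultranorm_0)
          qed (use \<open>\<epsilon> > 0\<close> in simp)
          then obtain B y where By: "B \<in> \<C>" "y \<in> restr W (S B)" "ultranorm (x - y) \<le> \<epsilon> / 2"
            by blast
          have "y \<in> closed_span B"
            using By(1,2) \<C>(1) by (auto simp: \<Q>_def)
          then have "y \<in> closed_span (\<Union>\<C>)"
            using closed_span_mono[of B "\<Union>\<C>"] By(1) by blast
          then show "\<exists>y\<in>closed_span (\<Union>\<C>). ultranorm (x - y) < \<epsilon>"
            using By(3) \<open>\<epsilon> > 0\<close> by (intro bexI[of _ y]) simp_all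
        qed
        then show "x \<in> closed_span (\<Union>\<C>)"
          by (simp add: closed_span_def)
      qed
    qed
    moreover have "good W (S (\<Union>\<C>))"
      unfolding good_def
    proof (intro ballI allI impI)
      fix x and r :: real
      assume x: "x \<in> W" and r: "0 \<le> r" "\<forall>e. e \<notin> S (\<Union>\<C>) \<longrightarrow> ultranorm (coord x e) \<le> r"
      show "\<exists>y\<in>restr W (S (\<Union>\<C>)). ultranorm (x - y) \<le> r"
      proof (cases "r = 0")
        case True
        then have "coord x e = 0" if "e \<notin> S (\<Union>\<C>)" for e
          using r(2) that ultranorm_nonneg[of "coord x e"] ultranorm_eq_0_iff[of "coord x e"] by force
        then have "x \<in> restr W (S (\<Union>\<C>))"
          using x by (intro restrI)
        then show ?thesis
          using r(1) by (intro bexI[of _ x]) (simp_all add: ultranorm_0)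
      next
        case False
        then obtain B y where By: "B \<in> \<C>" "y \<in> restr W (S B)" "ultranorm (x - y) \<le> r"
          using near[OF x, of r] r by auto
        have "restr W (S B) \<subseteq> restr W (S (\<Union>\<C>))"
          using By(1) by (intro restr_mono S_mono) blast
        then show ?thesis
          using By(2,3) by blast
      qed
    qed
    ultimately show ?thesis
      using orth by (simp add: \<Q>_def)
  qed
  then obtain B where B: "B \<in> \<Q>" and max: "\<And>A. A \<in> \<Q> \<Longrightarrow> B \<subseteq> A \<Longrightarrow> A = B"
    using subset_Zorn_nonempty[of \<Q>] \<open>{} \<in> \<Q>\<close> by blast
  define J where "J = S B"
  have BJ: "orthonormal B" "closed_span B = restr W J" "good W J"
    using B by (simp_all add: \<Q>_def J_def)
  have "W \<subseteq> restr W J"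
  proof
    fix x assume x: "x \<in> W"
    obtain C X where C: "supp x \<subseteq> C" "good W (J \<union> C)" and X: "countable X" "X \<subseteq> restr W (J \<union> C)"
      and dense: "restr W (J \<union> C) \<subseteq> closed_span (restr W J \<union> X)"
      by (rule good_extension[OF W(1) BJ(3) countable_supp])
    define W' where "W' = restr W (J \<union> C)"
    have W': "subspace W'" "closed W'"
      unfolding W'_def by (intro subspace_restr closed_restr W)+
    have restr_W': "restr W' J = restr W J"
      unfolding W'_def by (rule restr_restr) blast
    have good_W': "good W' J"
      unfolding good_def restr_W'
    proof (intro ballI allI impI)
      fix z and r :: real
      assume "z \<in> W'" and r: "0 \<le> r" "\<forall>e. e \<notin> J \<longrightarrow> ultranorm (coord z e) \<le> r"
      then have "z \<in> W"
        using restr_subset unfolding W'_def by blast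
      obtain y where "y \<in> restr W J" "ultranorm (z - y) \<le> r"
        by (rule goodD[OF BJ(3) \<open>z \<in> W\<close> r(1)]) (use r(2) in blast)
      then show "\<exists>y\<in>restr W J. ultranorm (z - y) \<le> r" by blast
    qed
    have "B \<subseteq> restr W' J"
      unfolding restr_W' BJ(2)[symmetric] by (rule closed_span_superset)
    then obtain B' where B': "B \<subseteq> B'" "B' \<subseteq> W'" "orthonormal B'" "X \<subseteq> span (restr W' J \<union> B')"
      by (rule gram_schmidt[OF W'(1) good_W' BJ(1) _ X(1) X(2)[folded W'_def]])
    have "restr W J \<subseteq> closed_span B'"
      using closed_span_mono[OF B'(1)] BJ(2) by simp
    moreover from this have "span (restr W' J \<union> B') \<subseteq> closed_span B'"
      unfolding restr_W' using closed_span_superset[of B']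
      by (intro span_minimal subspace_closed_span) blast
    ultimately have "closed_span (restr W J \<union> X) \<subseteq> closed_span B'"
      using B'(4) by (intro closed_span_subset) blast
    then have span_B': "closed_span B' = restr W (J \<union> C)"
      using dense closed_span_minimal[OF B'(2) W'] by (auto simp: W'_def)
    then have "B' \<in> \<Q>"
      using good_support[OF C(2) W span_B'] B'(3) by (simp add: \<Q>_def S_def)
    then have "B' = B"
      using max B'(1) by blast
    then have "restr W (J \<union> C) = restr W J"
      using span_B' BJ(2) by simp
    moreover have "x \<in> restr W (J \<union> C)"
      using x C(1) by (auto simp: restr_def)
    ultimately show "x \<in> restr W J" by simp
  qed
  then have "closed_span B = W"
    using BJ(2) restr_subset by blast
  with BJ(1) that show thesis by blast
qed

end

context ultrametric_banach_space
begin

lemma has_sum_scale_ultranorm: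
  assumes "(f has_sum v) E"
  shows "((\<lambda>e. a *s f e) has_sum (a *s v)) E"
proof (cases "a = 0")
  case True
  then show ?thesis
    by (simp add: has_sum_ultranorm ultranorm_0) (blast intro: finite.emptyI)
next
  case False
  then have a: "ultranorm a > 0"
    using ultranorm_nonneg[of a] ultranorm_eq_0_iff[of a] by simp
  show ?thesis
    unfolding has_sum_ultranorm
  proof (intro allI impI)
    fix \<epsilon> :: real assume "\<epsilon> > 0"
    with a have "\<epsilon> / ultranorm a > 0"
      by simp
    then obtain F0 where F0: "finite F0 \<and> F0 \<subseteq> E \<and>
        (\<forall>F. finite F \<and> F0 \<subseteq> F \<and> F \<subseteq> E \<longrightarrow> ultranorm (v - sum f F) < \<epsilon> / ultranorm a)"
      using assms unfolding has_sum_ultranorm by (elim allE[of _ "\<epsilon> / ultranorm a"] impE exE)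
    have "ultranorm (a *s v - (\<Sum>e\<in>F. a *s f e)) < \<epsilon>" if F: "finite F" "F0 \<subseteq> F" "F \<subseteq> E" for F
    proof -
      have "a *s v - (\<Sum>e\<in>F. a *s f e) = a *s (v - sum f F)"
        by (simp add: scale_right_diff_distrib scale_sum_right)
      moreover have "ultranorm (v - sum f F) < \<epsilon> / ultranorm a"
        using F F0 by simp
      ultimately show ?thesis
        using a by (simp only: ultranorm_scale) (simp add: pos_less_divide_eq mult.commute)
    qed
    then show "\<exists>F0. finite F0 \<and> F0 \<subseteq> E \<and>
        (\<forall>F. finite F \<and> F0 \<subseteq> F \<and> F \<subseteq> E \<longrightarrow> ultranorm (a *s v - (\<Sum>e\<in>F. a *s f e)) < \<epsilon>)"
      using F0 by (intro exI[of _ F0]) simp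
  qed
qed

lemma orthonormal_coordinates:
  assumes E: "orthonormal E" and UNIV: "closed_span E = UNIV"
  obtains coord :: "'v \<Rightarrow> 'v \<Rightarrow> 'k" where "coordinatized_banach_space scale coord"
proof -
  have "\<forall>v. \<exists>c\<in>C0 E. ((\<lambda>e. c e *s e) has_sum v) E"
    using orthonormal_expansion[OF E] UNIV by (metis UNIV_I)
  then obtain c where c: "\<And>v. c v \<in> C0 E" "\<And>v. ((\<lambda>e. c v e *s e) has_sum v) E"
    by metis
  define coord where "coord v e = (if e \<in> E then c v e else 0)" for v e
  have sums: "((\<lambda>e. coord v e *s e) has_sum v) E" for v
    using c(2)[of v] by (rule has_sum_cong[THEN iffD1, rotated]) (simp add: coord_def)
  have unique: "d e = coord v e" if "((\<lambda>e. d e *s e) has_sum v) E" "e \<in> E" for d v e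
  proof -
    have "((\<lambda>e. (d e - coord v e) *s e) has_sum (v - v)) E"
      using has_sum_ultranorm_diff[OF that(1) sums[of v]] by (simp add: scale_left_diff_distrib)
    then have "ultranorm (d e - coord v e) \<le> 0"
      using orthonormal_coeff_le[OF E _ that(2), of "\<lambda>e. d e - coord v e" "v - v"] by (simp add: ultranorm_0)
    then show ?thesis
      using ultranorm_nonneg[of "d e - coord v e"] ultranorm_eq_0_iff[of "d e - coord v e"] by simp
  qed
  have "coordinatized_banach_space scale coord"
  proof
    fix x y :: 'v and e
    have "((\<lambda>e. (coord x e - coord y e) *s e) has_sum (x - y)) E"
      using has_sum_ultranorm_diff[OF sums[of x] sums[of y]] by (simp add: scale_left_diff_distrib)
    then show "coord (x - y) e = coord x e - coord y e"
      using unique[of "\<lambda>e. coord x e - coord y e" "x - y" e] by (cases "e \<in> E") (auto simp: coord_def)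
  next
    fix a x e
    have "((\<lambda>e. (a * coord x e) *s e) has_sum (a *s x)) E"
      using has_sum_scale_ultranorm[OF sums[of x], of a] by simp
    then show "coord (a *s x) e = a * coord x e"
      using unique[of "\<lambda>e. a * coord x e" "a *s x" e] by (cases "e \<in> E") (auto simp: coord_def)
  next
    fix r :: real and x assume "0 \<le> r"
    show "ultranorm x \<le> r \<longleftrightarrow> (\<forall>e. ultranorm (coord x e) \<le> r)"
    proof
      assume x: "ultranorm x \<le> r"
      have "ultranorm (coord x e) \<le> r" for e
      proof (cases "e \<in> E")
        case True
        then show ?thesis
          using orthonormal_coeff_le[OF E sums True, of x] x by simp
      next
        case False
        then show ?thesis
          using \<open>0 \<le> r\<close> by (simp add: coord_def ultranorm_0)
      qed
      then show "\<forall>e. ultranorm (coord x e) \<le> r" ..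
    next
      assume "\<forall>e. ultranorm (coord x e) \<le> r"
      then show "ultranorm x \<le> r"
        using \<open>0 \<le> r\<close> by (intro orthonormal_sum_le[OF E sums]) auto
    qed
  next
    fix \<epsilon> :: real and x assume "\<epsilon> > 0"
    then have "{e. \<epsilon> \<le> ultranorm (coord x e)} = {e \<in> E. \<epsilon> \<le> ultranorm (c x e)}"
      by (auto simp: coord_def ultranorm_0 split: if_splits)
    then show "finite {e. \<epsilon> \<le> ultranorm (coord x e)}"
      using c(1)[of x] \<open>\<epsilon> > 0\<close> by (simp add: C0_def)
  qed
  with that show thesis .
qed

lemma free_closed_subspace:
  assumes "free UNIV"
  shows "free (closed_span S)"
proof -
  have "\<exists>E. orthonormal E \<and> closed_span E = UNIV"
    using assms free_closed_span_iff[of UNIV] by (simp add: closed_span_UNIV)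
  then obtain E where "orthonormal E" "closed_span E = UNIV"
    by blast
  then obtain coord :: "'v \<Rightarrow> 'v \<Rightarrow> 'k" where "coordinatized_banach_space scale coord"
    by (rule orthonormal_coordinates)
  then interpret coordinatized_banach_space scale coord .
  obtain B where "orthonormal B" "closed_span B = closed_span S"
    by (rule closed_subspace_has_orthonormal_basis[OF subspace_closed_span closed_closed_span])
  then show ?thesis
    unfolding free_closed_span_iff by blast
qed

end


section \<open>Freeness and almost freeness\<close>

theorem theorem6p1:
  fixes scale :: "'k :: complete_valuation_field \<Rightarrow> 'v :: complete_ultranormed_group \<Rightarrow> 'v"
  assumes "ultrametric_banach_space scale"
    and "|UNIV :: 'v set| =o ultrametric_banach_space.Banach_rank scale UNIV"
    and "weakly_compact_cardinal (ultrametric_banach_space.Banach_rank scale UNIV)"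
  shows "ultrametric_banach_space.free scale UNIV \<longleftrightarrow>
         ultrametric_banach_space.almost_free scale UNIV"
proof -
  interpret ultrametric_banach_space scale by (fact assms(1))
  show ?thesis
  proof
    assume "free UNIV"
    then show "almost_free UNIV"
      by (simp add: almost_free_def cardinal_free_def free_closed_subspace)
  next
    assume "almost_free UNIV"
    then have free: "free (closed_span S)" if "|S| <o |UNIV :: 'v set|" for S
      using ordLess_ordIso_trans[OF that assms(2)] by (simp add: almost_free_def cardinal_free_def)
    have "weakly_compact_cardinal |UNIV :: 'v set|"
      using assms(3) ordIso_symmetric[OF assms(2)] by (rule weakly_compact_cardinal_ordIso)
    then interpret weakly_compact_banach_space scale "|UNIV :: 'v set|"
      by unfold_locales (simp_all add: Field_card_of)
    show "free UNIV"
      using free by (intro free_if_cardinal_free) (simp add: cardinal_free_def)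
  qed
qed

end
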